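(* The class of $CC$-Maslyuchenko spaces is $M$-stable.
   Context: Conventions: regular and paracompact spaces are understood to be Hausdorff. $D(f)$ denotes the set of discontinuity points of a function $f$. A subset of a topological space $X$ is meager if it is a countable union of nowhere dense subsets of $X$. A topological space $Z$ is $CC$-Maslyuchenko if for all separable metrizable spaces $X,Y$ and every separately continuous function $f:X\times Y\to Z$ the projections of $D(f)\subset X\times Y$ on $X$ and on $Y$ are meager in $X$ and $Y$, respectively. A family $\mathcal N$ of subsets of a topological space $X$ is a $k$-network if for any compact $K\subset X$ and any neighborhood $O_K\subset X$ of $K$ there is a finite subfamily $\mathcal F\subset\mathcal N$ with $K\subset\bigcup\mathcal F\subset O_K$. An $\aleph_0$-space is a regular space with a countable $k$-network. A closed subset $A$ of a space $X$ is: a $\bar G_\delta$-set in $X$ if $A=\bigcap_{n\in\omega}\overline{U_n}$ for some sequence $(U_n)_{n\in\omega}$ of open sets in $X$; a retract of $X$ if there is a continuous map $r:X\to A$ with $r(a)=a$ for all $a\in A$; a neighborhood retract in $X$ if $A$ is a retract of some closed neighborhood $\bar U$ of $A$ in $X$. Michael modification: let $g:L\to X$ be a continuous map from a locally compact paracompact space $(L,\tau_L)$ to a space $(X,\tau_X)$ such that $L\cap(X\setminus g(L))=\emptyset$. The Michael modification of $X$ by $g$ is the set $X_g=L\cup(X\setminus g(L))$ with the topology generated by the base $\tau_L\cup\{g^{-1}(U)\cup(U\setminus g(L)):U\in\tau_X\}$. Function spaces: $C(X,Y)$ is the set of continuous functions $X\to Y$; $\tau_k$ (resp. $\tau_p$)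 is the topology on $C(X,Y)$ generated by the subbase of sets $\{f\in C(X,Y):f(K)\subset U\}$, with $K\subset X$ compact (resp. finite) and $U\subset Y$ open. A topology $\tau$ on a subset $Z\subset C(X,Y)$ is admissible if $\tau_p|Z\subset\tau\subset\tau_k|Z$ (where $|Z$ denotes the induced topology), and sequentially admissible if it is admissible and the evaluation map $e:Z\times X\to Y$, $e(f,x)=f(x)$, is sequentially continuous (maps convergent sequences to sequences converging to the image of the limit). A class $\mathcal C$ of topological spaces is $M$-stable if it contains all metrizable spaces and is closed under taking: (1) subspaces, homeomorphic images, and countable Tychonoff products; (2) fibered preimages: $X\in\mathcal C$ whenever there is a continuous map $f:X\to Y$ into a paracompact space $Y\in\mathcal C$ such that each $y\in Y$ has a neighborhood $O_y\subset Y$ with $f^{-1}(O_y)\in\mathcal C$; (3) strong $\bar\sigma$-sums: $X\in\mathcal C$ whenever $X=\bigcup_{n\in\omega}X_n$ for an increasing sequence of closed subsets $X_n\in\mathcal C$ of $X$ such that each convergent sequence in $X$ is contained in some $X_n$; (4) $\bar G_\delta$-retral unions: $X\in\mathcal C$ whenever $X=X_1\cup\dots\cup X_n$ for some $\bar G_\delta$-sets $X_1,\dots,X_n$ in $X$ that belong to $\mathcal C$ and are neighborhood retracts in $X$; (5) Michael modifications: $X_g\in\mathcal C$ for every Hausdorff $X\in\mathcal C$ and every continuous map $g:L\to X$ from a locally compact paracompact space $L\in\mathcal C$ such that $L\cap(X\setminus g(L))=\emptyset$, where $X_g$ is the Michael modification of $X$ by $g$; (6) sequentially admissible function spaces: for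 every $\aleph_0$-space $X$ and every $Y\in\mathcal C$, every subset $Z\subset C(X,Y)$ endowed with a sequentially admissible topology belongs to $\mathcal C$. *)

theory Defs
  imports "HOL-Analysis.Analysis"
begin

section \<open>Meager sets and discontinuity points\<close>

definition nowhere_dense_in :: "'a topology \<Rightarrow> 'a set \<Rightarrow> bool" where
  "nowhere_dense_in X A \<longleftrightarrow> A \<subseteq> topspace X \<and> X interior_of (X closure_of A) = {}"

definition meager_in :: "'a topology \<Rightarrow> 'a set \<Rightarrow> bool" where
  "meager_in X A \<longleftrightarrow> (\<exists>\<N>. countable \<N> \<and> (\<forall>N\<in>\<N>. nowhere_dense_in X N) \<and> A = \<Union>\<N>)"

definition disc_points :: "'a topology \<Rightarrow> 'b topology \<Rightarrow> ('a \<Rightarrow> 'b) \<Rightarrow> 'a set" where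
  "disc_points X Y f = {x \<in> topspace X. \<not> topcontinuous_at X Y f x}"

definition separately_continuous ::
  "'a topology \<Rightarrow> 'b topology \<Rightarrow> 'c topology \<Rightarrow> ('a \<times> 'b \<Rightarrow> 'c) \<Rightarrow> bool" where
  "separately_continuous X Y Z f \<longleftrightarrow>
     (\<forall>x\<in>topspace X. continuous_map Y Z (\<lambda>y. f (x, y))) \<and>
     (\<forall>y\<in>topspace Y. continuous_map X Z (\<lambda>x. f (x, y)))"

section \<open>CC-Maslyuchenko spaces\<close>

text \<open>A definition cannot quantify over the types of points of \<open>X\<close> and \<open>Y\<close>. Every separable
  metrizable space is homeomorphic to one whose points are of type \<^typ>\<open>nat \<Rightarrow> real\<close>, so quantifying
  over all separable metrizable topologies on subsets of that type loses nothing; lemma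
  \<open>CC_MaslyuchenkoD\<close> below derives the property for separable metrizable spaces over arbitrary
  types.\<close>

definition CC_Maslyuchenko :: "'z topology \<Rightarrow> bool" where
  "CC_Maslyuchenko Z \<longleftrightarrow>
     (\<forall>(X :: (nat \<Rightarrow> real) topology) (Y :: (nat \<Rightarrow> real) topology) f.
        separable_space X \<and> metrizable_space X \<and> separable_space Y \<and> metrizable_space Y \<and>
        separately_continuous X Y Z f \<longrightarrow>
        meager_in X (fst ` disc_points (prod_topology X Y) Z f) \<and>
        meager_in Y (snd ` disc_points (prod_topology X Y) Z f))"

lemma separable_metrizable_coordinates:
  fixes X :: "'x topology"
  assumes "separable_space X" "metrizable_space X"
  obtains X' :: "(nat \<Rightarrow> real) topology" and j h
  where "homeomorphic_maps X X' j h" "separable_space X'" "metrizable_space X'"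
proof -
  obtain M d where Md: "Metric_space M d" "X = Metric_space.mtopology M d"
    using assms(2) by (auto simp: metrizable_space_def)
  interpret Metric_space M d by (fact Md)
  have top: "topspace X = M" using Md by simp
  obtain Q where Q: "countable Q" "Q \<subseteq> topspace X" "X closure_of Q = topspace X"
    using assms(1) by (auto simp: separable_space_def)
  define j where "j x = (\<lambda>n. if Q = {} then 0 else d x (from_nat_into Q n))" for x
  have inj: "inj_on j (topspace X)"
  proof (rule inj_onI)
    fix x y assume x: "x \<in> topspace X" and y: "y \<in> topspace X" and eq: "j x = j y"
    show "x = y"
    proof (rule ccontr)
      assume "x \<noteq> y"
      then have pos: "0 < d x y / 2" using x y top by (simp add: mdist_pos_less)
      have "x \<in> X closure_of Q" using Q x by simp
      then obtain q where q: "q \<in> Q" "q \<in> mball x (d x y / 2)"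
        using pos unfolding Md(2) metric_closure_of by blast
      then obtain n where n: "from_nat_into Q n = q"
        using Q(1) by (metis from_nat_into_surj)
      have "d x q = d y q" using eq n q(1) unfolding j_def by (metis empty_iff)
      moreover have "d x q < d x y / 2" "q \<in> M" using q(2) by auto
      moreover have "d x y \<le> d x q + d q y" using x y top \<open>q \<in> M\<close> triangle by simp
      moreover have "d q y = d y q" by (simp add: commute)
      ultimately show False by simp
    qed
  qed
  define h where "h = inv_into (topspace X) j"
  define X' where "X' = pullback_topology (j ` topspace X) h X"
  have hj: "h (j x) = x" if "x \<in> topspace X" for x
    using inj that by (simp add: h_def)
  have top': "topspace X' = j ` topspace X"
    by (auto simp: X'_def topspace_pullback_topology hj)
  have ch: "continuous_map X' X h"
    unfolding X'_def using continuous_map_pullback[OF continuous_map_id, of "j ` topspace X" h X]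
    by simp
  have cj: "continuous_map X X' j"
    unfolding X'_def
  proof (rule continuous_map_pullback')
    show "continuous_map X X (h \<circ> j)"
      by (rule continuous_map_eq[OF continuous_map_id]) (simp add: hj)
  qed auto
  have hm: "homeomorphic_maps X X' j h"
    unfolding homeomorphic_maps_def using cj ch hj top' by auto
  then have "X homeomorphic_space X'" by (auto simp: homeomorphic_space_def)
  with assms have "separable_space X'" "metrizable_space X'"
    using homeomorphic_separable_space homeomorphic_metrizable_space by blast+
  with hm that show ?thesis by blast
qed

lemma meager_in_subset:
  assumes "meager_in X B" "A \<subseteq> B"
  shows "meager_in X A"
proof -
  obtain \<N> where N: "countable \<N>" "\<forall>N\<in>\<N>. nowhere_dense_in X N" "B = \<Union>\<N>"
    using assms(1) by (auto simp: meager_in_def)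
  have "nowhere_dense_in X (N \<inter> A)" if "N \<in> \<N>" for N
  proof -
    have "X interior_of (X closure_of (N \<inter> A)) \<subseteq> X interior_of (X closure_of N)"
      by (intro interior_of_mono closure_of_mono) auto
    then show ?thesis using N(2) that by (auto simp: nowhere_dense_in_def)
  qed
  then have "\<forall>N\<in>(\<lambda>N. N \<inter> A) ` \<N>. nowhere_dense_in X N" by auto
  moreover have "A = \<Union>((\<lambda>N. N \<inter> A) ` \<N>)" using N(3) assms(2) by auto
  ultimately show ?thesis using N(1) unfolding meager_in_def by (metis countable_image)
qed

lemma meager_in_homeomorphic_image:
  assumes "homeomorphic_map X Y h" "meager_in X A"
  shows "meager_in Y (h ` A)"
proof -
  obtain \<N> where N: "countable \<N>" "\<forall>N\<in>\<N>. nowhere_dense_in X N" "A = \<Union>\<N>"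
    using assms(2) by (auto simp: meager_in_def)
  have "nowhere_dense_in Y (h ` N)" if "N \<in> \<N>" for N
  proof -
    have sub: "N \<subseteq> topspace X" and int: "X interior_of (X closure_of N) = {}"
      using N(2) that by (auto simp: nowhere_dense_in_def)
    have "Y interior_of (Y closure_of (h ` N)) = h ` (X interior_of (X closure_of N))"
      using homeomorphic_map_closure_of[OF assms(1) sub]
        homeomorphic_map_interior_of[OF assms(1) closure_of_subset_topspace] by metis
    moreover have "h ` N \<subseteq> topspace Y"
      using sub assms(1) homeomorphic_imp_surjective_map by blast
    ultimately show ?thesis using int by (simp add: nowhere_dense_in_def)
  qed
  then have "\<forall>N\<in>(`) h ` \<N>. nowhere_dense_in Y N" by auto
  moreover have "h ` A = \<Union>((`) h ` \<N>)" using N(3) by auto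
  ultimately show ?thesis using N(1) unfolding meager_in_def by (metis countable_image)
qed

lemma CC_MaslyuchenkoD:
  fixes X :: "'x topology" and Y :: "'y topology" and Z :: "'z topology"
  assumes Z: "CC_Maslyuchenko Z"
    and X: "separable_space X" "metrizable_space X"
    and Y: "separable_space Y" "metrizable_space Y"
    and f: "separately_continuous X Y Z f"
  shows "meager_in X (fst ` disc_points (prod_topology X Y) Z f)"
    and "meager_in Y (snd ` disc_points (prod_topology X Y) Z f)"
proof -
  obtain X' :: "(nat \<Rightarrow> real) topology" and j h where X':
    "homeomorphic_maps X X' j h" "separable_space X'" "metrizable_space X'"
    using separable_metrizable_coordinates[OF X] by blast
  obtain Y' :: "(nat \<Rightarrow> real) topology" and k l where Y':
    "homeomorphic_maps Y Y' k l" "separable_space Y'" "metrizable_space Y'"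
    using separable_metrizable_coordinates[OF Y] by blast
  have cX: "continuous_map X X' j" "continuous_map X' X h" "\<And>x. x \<in> topspace X \<Longrightarrow> h (j x) = x"
    using X'(1) by (auto simp: homeomorphic_maps_def)
  have cY: "continuous_map Y Y' k" "continuous_map Y' Y l" "\<And>y. y \<in> topspace Y \<Longrightarrow> l (k y) = y"
    using Y'(1) by (auto simp: homeomorphic_maps_def)
  have inX: "h x \<in> topspace X" if "x \<in> topspace X'" for x
    using cX(2) that by (auto simp: continuous_map_def)
  have inX': "j x \<in> topspace X'" if "x \<in> topspace X" for x
    using cX(1) that by (auto simp: continuous_map_def)
  have inY: "l x \<in> topspace Y" if "x \<in> topspace Y'" for x
    using cY(2) that by (auto simp: continuous_map_def)
  have inY': "k x \<in> topspace Y'" if "x \<in> topspace Y" for x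
    using cY(1) that by (auto simp: continuous_map_def)
  define f' where "f' p = f (h (fst p), l (snd p))" for p
  have f': "separately_continuous X' Y' Z f'"
    unfolding separately_continuous_def
  proof (intro conjI ballI)
    fix x assume "x \<in> topspace X'"
    then have "continuous_map Y Z (\<lambda>y. f (h x, y))"
      using f inX by (auto simp: separately_continuous_def)
    from continuous_map_compose[OF cY(2) this]
    show "continuous_map Y' Z (\<lambda>y. f' (x, y))" by (simp add: f'_def o_def)
  next
    fix y assume "y \<in> topspace Y'"
    then have "continuous_map X Z (\<lambda>x. f (x, l y))"
      using f inY by (auto simp: separately_continuous_def)
    from continuous_map_compose[OF cX(2) this]
    show "continuous_map X' Z (\<lambda>x. f' (x, y))" by (simp add: f'_def o_def)
  qed
  define D where "D = disc_points (prod_topology X Y) Z f"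
  define D' where "D' = disc_points (prod_topology X' Y') Z f'"
  have m: "meager_in X' (fst ` D')" "meager_in Y' (snd ` D')"
    using Z X' Y' f' unfolding CC_Maslyuchenko_def D'_def by blast+
  let ?J = "\<lambda>p. (j (fst p), k (snd p))"
  have cJ: "continuous_map (prod_topology X Y) (prod_topology X' Y') ?J"
    by (intro continuous_map_pairedI)
      (use continuous_map_compose[OF continuous_map_fst cX(1)]
           continuous_map_compose[OF continuous_map_snd cY(1)] in \<open>simp_all add: o_def\<close>)
  have fZ: "f \<in> topspace (prod_topology X Y) \<rightarrow> topspace Z"
  proof (rule funcsetI)
    fix p assume "p \<in> topspace (prod_topology X Y)"
    moreover obtain a b where "p = (a, b)" by (cases p)
    ultimately show "f p \<in> topspace Z"
      using f by (auto simp: separately_continuous_def continuous_map_def)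
  qed
  have DD': "?J p \<in> D'" if p: "p \<in> D" for p
  proof (rule ccontr)
    have pT: "p \<in> topspace (prod_topology X Y)"
      using p by (simp add: D_def disc_points_def)
    then have JT: "?J p \<in> topspace (prod_topology X' Y')"
      using inX' inY' by auto
    assume "?J p \<notin> D'"
    then have tc: "topcontinuous_at (prod_topology X' Y') Z f' (?J p)"
      using JT unfolding D'_def disc_points_def by blast
    have fJ: "f' (?J q) = f q" if "q \<in> topspace (prod_topology X Y)" for q
      using that cX(3) cY(3) by (auto simp: f'_def)
    have "topcontinuous_at (prod_topology X Y) Z f p"
      unfolding topcontinuous_at_def
    proof (intro conjI allI impI)
      fix V assume "openin Z V \<and> f p \<in> V"
      then obtain U where U: "openin (prod_topology X' Y') U" "?J p \<in> U" "\<forall>q\<in>U. f' q \<in> V"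
        using tc fJ[OF pT] unfolding topcontinuous_at_def by metis
      let ?U = "{q \<in> topspace (prod_topology X Y). ?J q \<in> U}"
      have "openin (prod_topology X Y) ?U"
        using openin_continuous_map_preimage[OF cJ U(1)] .
      moreover have "p \<in> ?U" using pT U(2) by blast
      moreover have "\<forall>q\<in>?U. f q \<in> V" using fJ U(3) by fastforce
      ultimately show "\<exists>U. openin (prod_topology X Y) U \<and> p \<in> U \<and> (\<forall>y\<in>U. f y \<in> V)"
        by blast
    qed (use pT fZ in auto)
    then show False using p by (simp add: D_def disc_points_def)
  qed
  have DT: "fst p \<in> topspace X" "snd p \<in> topspace Y" if "p \<in> D" for p
    using that by (auto simp: D_def disc_points_def)
  have "fst ` D \<subseteq> h ` fst ` D'"
  proof
    fix x assume "x \<in> fst ` D"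
    then obtain p where p: "p \<in> D" "x = fst p" by blast
    then have eq: "x = h (fst (?J p))" using DT cX(3) by simp
    have "h (fst (?J p)) \<in> h ` fst ` D'" by (intro imageI DD'[OF p(1)])
    then show "x \<in> h ` fst ` D'" unfolding eq .
  qed
  moreover have "homeomorphic_map X' X h"
    by (rule homeomorphic_maps_imp_map[OF homeomorphic_maps_sym[THEN iffD1, OF X'(1)]])
  ultimately show "meager_in X (fst ` disc_points (prod_topology X Y) Z f)"
    using meager_in_subset[OF meager_in_homeomorphic_image[OF _ m(1)]] unfolding D_def by simp
  have "snd ` D \<subseteq> l ` snd ` D'"
  proof
    fix y assume "y \<in> snd ` D"
    then obtain p where p: "p \<in> D" "y = snd p" by blast
    then have eq: "y = l (snd (?J p))" using DT cY(3) by simp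
    have "l (snd (?J p)) \<in> l ` snd ` D'" by (intro imageI DD'[OF p(1)])
    then show "y \<in> l ` snd ` D'" unfolding eq .
  qed
  moreover have "homeomorphic_map Y' Y l"
    by (rule homeomorphic_maps_imp_map[OF homeomorphic_maps_sym[THEN iffD1, OF Y'(1)]])
  ultimately show "meager_in Y (snd ` disc_points (prod_topology X Y) Z f)"
    using meager_in_subset[OF meager_in_homeomorphic_image[OF _ m(2)]] unfolding D_def by simp
qed

section \<open>Classes of spaces and special subsets\<close>

text \<open>Paracompact spaces and \<open>\<aleph>\<^sub>0\<close>-spaces are Hausdorff by convention; \<^const>\<open>regular_space\<close> does
  not include any point separation.\<close>

definition paracompact_space :: "'a topology \<Rightarrow> bool" where
  "paracompact_space X \<longleftrightarrow> Hausdorff_space X \<and>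
     (\<forall>\<U>. (\<forall>U\<in>\<U>. openin X U) \<and> \<Union>\<U> = topspace X \<longrightarrow>
        (\<exists>\<V>. (\<forall>V\<in>\<V>. openin X V) \<and> \<Union>\<V> = topspace X \<and>
             (\<forall>V\<in>\<V>. \<exists>U\<in>\<U>. V \<subseteq> U) \<and> locally_finite_in X \<V>))"

text \<open>A neighborhood of a set (or of a point, taking a singleton) need not be open.\<close>

definition nbhd_in :: "'a topology \<Rightarrow> 'a set \<Rightarrow> 'a set \<Rightarrow> bool" where
  "nbhd_in X A N \<longleftrightarrow> N \<subseteq> topspace X \<and> (\<exists>U. openin X U \<and> A \<subseteq> U \<and> U \<subseteq> N)"

definition k_network :: "'a topology \<Rightarrow> 'a set set \<Rightarrow> bool" where
  "k_network X \<N> \<longleftrightarrow> (\<forall>N\<in>\<N>. N \<subseteq> topspace X) \<and>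
     (\<forall>K W. compactin X K \<and> nbhd_in X K W \<longrightarrow>
        (\<exists>\<F>. finite \<F> \<and> \<F> \<subseteq> \<N> \<and> K \<subseteq> \<Union>\<F> \<and> \<Union>\<F> \<subseteq> W))"

definition aleph0_space :: "'a topology \<Rightarrow> bool" where
  "aleph0_space X \<longleftrightarrow> Hausdorff_space X \<and> regular_space X \<and> (\<exists>\<N>. countable \<N> \<and> k_network X \<N>)"

definition bar_G_delta_in :: "'a topology \<Rightarrow> 'a set \<Rightarrow> bool" where
  "bar_G_delta_in X A \<longleftrightarrow> closedin X A \<and>
     (\<exists>U :: nat \<Rightarrow> 'a set. (\<forall>n. openin X (U n)) \<and> A = (\<Inter>n. X closure_of (U n)))"

definition neighborhood_retract_in :: "'a topology \<Rightarrow> 'a set \<Rightarrow> bool" where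
  "neighborhood_retract_in X A \<longleftrightarrow> closedin X A \<and>
     (\<exists>N. closedin X N \<and> nbhd_in X A N \<and> A retract_of_space (subtopology X N))"

section \<open>Michael modifications\<close>

text \<open>The points of \<open>L\<close> and of \<open>X - g(L)\<close> live in one ambient type, and the underlying
  set is the plain union \<open>L \<union> (X - g(L))\<close>; disjointness is a hypothesis where this is used.\<close>

definition Michael_base :: "'a topology \<Rightarrow> 'a topology \<Rightarrow> ('a \<Rightarrow> 'a) \<Rightarrow> 'a set set" where
  "Michael_base L X g = {V. openin L V} \<union>
     {{x \<in> topspace L. g x \<in> U} \<union> (U - g ` topspace L) | U. openin X U}"

definition Michael_modification :: "'a topology \<Rightarrow> 'a topology \<Rightarrow> ('a \<Rightarrow> 'a) \<Rightarrow> 'a topology" where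
  "Michael_modification L X g = topology_generated_by (Michael_base L X g)"

lemma topspace_Michael_modification:
  assumes "continuous_map L X g"
  shows "topspace (Michael_modification L X g) = topspace L \<union> (topspace X - g ` topspace L)"
proof -
  have "\<Union>(Michael_base L X g) = topspace L \<union> (topspace X - g ` topspace L)"
    (is "?l = ?r")
  proof
    have "V \<subseteq> topspace L" if "openin L V" for V using that by (rule openin_subset)
    moreover have "U \<subseteq> topspace X" if "openin X U" for U using that by (rule openin_subset)
    ultimately show "?l \<subseteq> ?r" unfolding Michael_base_def by blast
    have "{x \<in> topspace L. g x \<in> topspace X} = topspace L"
      using assms by (auto simp: continuous_map_def)
    then have "?r \<in> Michael_base L X g"
      unfolding Michael_base_def using openin_topspace[of X] by blast
    then show "?r \<subseteq> ?l" by (rule Union_upper)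
  qed
  then show ?thesis by (simp add: Michael_modification_def)
qed

section \<open>Function spaces\<close>

text \<open>Functions are made \<^const>\<open>undefined\<close> outside the domain, so that an element of the function
  space is determined by its values on \<open>topspace X\<close>.\<close>

definition cont_maps :: "'x topology \<Rightarrow> 'y topology \<Rightarrow> ('x \<Rightarrow> 'y) set" where
  "cont_maps X Y = {f \<in> extensional (topspace X). continuous_map X Y f}"

definition compact_open_topology :: "'x topology \<Rightarrow> 'y topology \<Rightarrow> ('x \<Rightarrow> 'y) topology" where
  "compact_open_topology X Y =
     topology_generated_by {{f \<in> cont_maps X Y. f ` K \<subseteq> U} | K U. compactin X K \<and> openin Y U}"

definition pointwise_topology :: "'x topology \<Rightarrow> 'y topology \<Rightarrow> ('x \<Rightarrow> 'y) topology" where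
  "pointwise_topology X Y =
     topology_generated_by {{f \<in> cont_maps X Y. f ` F \<subseteq> U} | F U.
        finite F \<and> F \<subseteq> topspace X \<and> openin Y U}"

definition admissible_topology :: "'x topology \<Rightarrow> 'y topology \<Rightarrow> ('x \<Rightarrow> 'y) topology \<Rightarrow> bool" where
  "admissible_topology X Y T \<longleftrightarrow> topspace T \<subseteq> cont_maps X Y \<and>
     (\<forall>U. openin (subtopology (pointwise_topology X Y) (topspace T)) U \<longrightarrow> openin T U) \<and>
     (\<forall>U. openin T U \<longrightarrow> openin (subtopology (compact_open_topology X Y) (topspace T)) U)"

definition sequentially_continuous_map :: "'a topology \<Rightarrow> 'b topology \<Rightarrow> ('a \<Rightarrow> 'b) \<Rightarrow> bool" where
  "sequentially_continuous_map X Y f \<longleftrightarrow>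
     (\<forall>(s :: nat \<Rightarrow> 'a) l. range s \<subseteq> topspace X \<and> limitin X s l sequentially \<longrightarrow>
        limitin Y (f \<circ> s) (f l) sequentially)"

definition sequentially_admissible_topology ::
  "'x topology \<Rightarrow> 'y topology \<Rightarrow> ('x \<Rightarrow> 'y) topology \<Rightarrow> bool" where
  "sequentially_admissible_topology X Y T \<longleftrightarrow> admissible_topology X Y T \<and>
     sequentially_continuous_map (prod_topology T X) Y (\<lambda>(f, x). f x)"

section \<open>M-stable classes\<close>

text \<open>A class of topological spaces is represented by a polymorphic predicate on \<^typ>\<open>'a topology\<close>.
  HOL cannot pass a polymorphic predicate as an argument, so in the closure properties below
  \<open>C\<close>, \<open>C'\<close>, \<dots> stand for instances of one and the same class at different types of points.\<close>

definition contains_metrizable :: "('a topology \<Rightarrow> bool) \<Rightarrow> bool" where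
  "contains_metrizable C \<longleftrightarrow> (\<forall>X. metrizable_space X \<longrightarrow> C X)"

definition closed_under_subspaces :: "('a topology \<Rightarrow> bool) \<Rightarrow> bool" where
  "closed_under_subspaces C \<longleftrightarrow> (\<forall>X S. C X \<and> S \<subseteq> topspace X \<longrightarrow> C (subtopology X S))"

definition closed_under_homeomorphic_images ::
  "('a topology \<Rightarrow> bool) \<Rightarrow> ('b topology \<Rightarrow> bool) \<Rightarrow> bool" where
  "closed_under_homeomorphic_images C C' \<longleftrightarrow> (\<forall>X Y. C X \<and> X homeomorphic_space Y \<longrightarrow> C' Y)"

definition closed_under_countable_products ::
  "('a topology \<Rightarrow> bool) \<Rightarrow> (('i \<Rightarrow> 'a) topology \<Rightarrow> bool) \<Rightarrow> bool" where
  "closed_under_countable_products C C' \<longleftrightarrow>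
     (\<forall>I X. countable I \<and> (\<forall>i\<in>I. C (X i)) \<longrightarrow> C' (product_topology X I))"

definition closed_under_fibered_preimages ::
  "('a topology \<Rightarrow> bool) \<Rightarrow> ('b topology \<Rightarrow> bool) \<Rightarrow> bool" where
  "closed_under_fibered_preimages C C' \<longleftrightarrow>
     (\<forall>X Y f. paracompact_space Y \<and> C' Y \<and> continuous_map X Y f \<and>
        (\<forall>y\<in>topspace Y. \<exists>N. nbhd_in Y {y} N \<and> C (subtopology X {x \<in> topspace X. f x \<in> N})) \<longrightarrow>
        C X)"

definition closed_under_strong_sigma_sums :: "('a topology \<Rightarrow> bool) \<Rightarrow> bool" where
  "closed_under_strong_sigma_sums C \<longleftrightarrow>
     (\<forall>X (A :: nat \<Rightarrow> 'a set).
        topspace X = (\<Union>n. A n) \<and> incseq A \<and>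
        (\<forall>n. closedin X (A n) \<and> C (subtopology X (A n))) \<and>
        (\<forall>(s :: nat \<Rightarrow> 'a) l. range s \<subseteq> topspace X \<and> limitin X s l sequentially \<longrightarrow>
           (\<exists>n. range s \<subseteq> A n)) \<longrightarrow>
        C X)"

definition closed_under_retral_unions :: "('a topology \<Rightarrow> bool) \<Rightarrow> bool" where
  "closed_under_retral_unions C \<longleftrightarrow>
     (\<forall>X (n :: nat) A.
        topspace X = (\<Union>i\<in>{1..n}. A i) \<and>
        (\<forall>i\<in>{1..n}. bar_G_delta_in X (A i) \<and> neighborhood_retract_in X (A i) \<and>
                     C (subtopology X (A i))) \<longrightarrow>
        C X)"

definition closed_under_Michael_modifications :: "('a topology \<Rightarrow> bool) \<Rightarrow> bool" where
  "closed_under_Michael_modifications C \<longleftrightarrow>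
     (\<forall>X L g. Hausdorff_space X \<and> C X \<and>
        locally_compact_space L \<and> paracompact_space L \<and> C L \<and> continuous_map L X g \<and>
        topspace L \<inter> (topspace X - g ` topspace L) = {} \<longrightarrow>
        C (Michael_modification L X g))"

definition closed_under_function_spaces ::
  "('a topology \<Rightarrow> bool) \<Rightarrow> (('x \<Rightarrow> 'a) topology \<Rightarrow> bool) \<Rightarrow> bool" where
  "closed_under_function_spaces C C' \<longleftrightarrow>
     (\<forall>(X :: 'x topology) Y T. aleph0_space X \<and> C Y \<and> sequentially_admissible_topology X Y T \<longrightarrow>
        C' T)"

text \<open>The four arguments are the instances of the class at an arbitrary type of points, at a second
  arbitrary type, at a type carrying countable products, and at a type carrying function spaces.
  A polymorphic predicate is M-stable if this holds for its instances at all types.\<close>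

definition M_stable ::
  "('a topology \<Rightarrow> bool) \<Rightarrow> ('b topology \<Rightarrow> bool) \<Rightarrow> (('i \<Rightarrow> 'a) topology \<Rightarrow> bool) \<Rightarrow>
   (('x \<Rightarrow> 'a) topology \<Rightarrow> bool) \<Rightarrow> bool" where
  "M_stable C C' C_prod C_fun \<longleftrightarrow>
     contains_metrizable C \<and>
     closed_under_subspaces C \<and>
     closed_under_homeomorphic_images C C' \<and>
     closed_under_countable_products C C_prod \<and>
     closed_under_fibered_preimages C C' \<and>
     closed_under_strong_sigma_sums C \<and>
     closed_under_retral_unions C \<and>
     closed_under_Michael_modifications C \<and>
     closed_under_function_spaces C C_fun"

end

theory Submission
  imports Defs
begin

text \<open>
  The main constructions follow one scheme. Let \<open>f : X \<times> Y \<rightarrow> Z\<close> be separately continuous. By symmetry it is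
  enough to show that the projection on \<open>X\<close> of the set of discontinuity points is meager. If a set \<open>T \<subseteq> Z\<close> is closed and
  \<open>V\<close> runs through a countable base of \<open>Y\<close>, then the set of all \<open>x\<close> such that \<open>f\<close> maps \<open>{x} \<times> V\<close> into \<open>T\<close> is closed, since \<open>f\<close>
  is continuous in the first variable. The boundaries of countably many closed sets form a meager set. For \<open>x\<close> outside
  of it, whatever the section \<open>f (x, \<cdot>)\<close> does near \<open>y\<close> in terms of \<open>T\<close> it does on a whole box around \<open>(x, y)\<close>; there
  \<open>f\<close> is a separately continuous map into \<open>T\<close>, to which what is known about \<open>T\<close> applies. This is lemma
  \<open>meager_projection_of_closed_piece\<close>. For each construction it remains to find countably many closed pieces \<open>T\<close> that
  locally contain the vertical sections.

  For strong sums they are the summands: continuity of the section turns a failure into a convergent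
  sequence that lies in no summand. For retral unions they are the intersections of the closed neighborhoods of the
  pieces containing \<open>f (x, y)\<close> with the union of these pieces, and continuity of \<open>f\<close> is recovered from that of
  the maps \<open>f\<close> followed by a retraction. For Michael modifications they are the closures of countably many
  relatively compact open subsets of \<open>L\<close>; countably many suffice because the image of \<open>f\<close> is separable and \<open>L\<close> is paracompact. Values
  outside \<open>L\<close> are controlled by the projection to \<open>X\<close>. Metrizable targets are treated in the same way with the
  closed sets of small vertical oscillation. Subspaces, homeomorphic images, products and fibered preimages are local or
  coordinatewise arguments.

  Function spaces are reduced to their target. An \<open>\<aleph>\<^sub>0\<close>-space \<open>X\<close> is the image of a separable metrizable space \<open>M\<close> under a
  compact-covering map \<open>p\<close> (lemma \<open>aleph0_space_compact_covering_image\<close>). A separately continuous map \<open>f\<close> from \<open>A \<times> B\<close> to the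
  function space yields the separately continuous map \<open>(a, (b, m)) \<mapsto> f (a, b) (p m)\<close> on \<open>A \<times> (B \<times> M)\<close>, and the tube lemma
  translates its points of continuity back to those of \<open>f\<close> in the compact-open topology.
\<close>

section \<open>Separable metrizable spaces and second countability\<close>

lemma separable_metrizable_imp_second_countable:
  assumes "separable_space X" "metrizable_space X"
  shows "second_countable X"
proof -
  obtain M d where Md: "Metric_space M d" "X = Metric_space.mtopology M d"
    using assms(2) by (auto simp: metrizable_space_def)
  interpret Metric_space M d by (fact Md)
  obtain Q where Q: "countable Q" "Q \<subseteq> M" "X closure_of Q = M"
    using assms(1) Md(2) by (auto simp: separable_space_def)
  define \<B> where "\<B> = (\<lambda>(q, n::nat). mball q (inverse (Suc n))) ` (Q \<times> UNIV)"
  have "\<exists>V\<in>\<B>. x \<in> V \<and> V \<subseteq> U" if U: "openin X U" "x \<in> U" for U x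
  proof -
    obtain r where r: "r > 0" "mball x r \<subseteq> U"
      using U unfolding Md(2) openin_mtopology by blast
    obtain n where n: "inverse (real (Suc n)) < r / 2"
      using r(1) reals_Archimedean[of "r / 2"] by auto
    have xM: "x \<in> M" using U Md(2) openin_subset by fastforce
    then have "x \<in> X closure_of Q" using Q by simp
    then have "\<forall>r>0. \<exists>y\<in>Q. y \<in> mball x r" unfolding Md(2) metric_closure_of by blast
    moreover have "0 < inverse (real (Suc n))" by simp
    ultimately obtain q where q: "q \<in> Q" "q \<in> mball x (inverse (Suc n))" by blast
    have "mball q (inverse (Suc n)) \<subseteq> mball x r"
    proof
      fix z assume z: "z \<in> mball q (inverse (Suc n))"
      then have "d x z \<le> d x q + d q z" using xM q by (intro triangle) auto
      then show "z \<in> mball x r" using z q n xM by auto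
    qed
    moreover have "x \<in> mball q (inverse (Suc n))" using q by (auto simp: commute)
    ultimately show ?thesis
      using r q(1) unfolding \<B>_def by (intro bexI[of _ "mball q (inverse (Suc n))"]) auto
  qed
  moreover have "countable \<B>" unfolding \<B>_def using Q(1) by auto
  moreover have "\<forall>V\<in>\<B>. openin X V" unfolding \<B>_def Md(2) by auto
  ultimately show ?thesis unfolding second_countable_def by (intro exI[of _ \<B>]) auto
qed

lemma openin_prod_topology_boxE:
  assumes "openin (prod_topology X Y) W" "(x, y) \<in> W"
  obtains U V where "openin X U" "openin Y V" "x \<in> U" "y \<in> V" "U \<times> V \<subseteq> W"
  using assms(1)[unfolded openin_prod_topology_alt, rule_format, OF assms(2)] by (elim exE conjE)

lemma second_countable_prod_topology:
  assumes "second_countable X" "second_countable Y"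
  shows "second_countable (prod_topology X Y)"
proof -
  obtain \<A> where A: "countable \<A>" "\<And>U. U \<in> \<A> \<Longrightarrow> openin X U"
    "\<And>U x. openin X U \<Longrightarrow> x \<in> U \<Longrightarrow> \<exists>V\<in>\<A>. x \<in> V \<and> V \<subseteq> U"
    using assms(1) by (auto simp: second_countable_def)
  obtain \<B> where B: "countable \<B>" "\<And>V. V \<in> \<B> \<Longrightarrow> openin Y V"
    "\<And>U y. openin Y U \<Longrightarrow> y \<in> U \<Longrightarrow> \<exists>V\<in>\<B>. y \<in> V \<and> V \<subseteq> U"
    using assms(2) by (auto simp: second_countable_def)
  let ?C = "(\<lambda>(U, V). U \<times> V) ` (\<A> \<times> \<B>)"
  have "\<exists>C\<in>?C. p \<in> C \<and> C \<subseteq> W" if W: "openin (prod_topology X Y) W" "p \<in> W" for W p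
  proof -
    obtain x y where p: "p = (x, y)" by (cases p)
    obtain U V where UV: "openin X U" "openin Y V" "x \<in> U" "y \<in> V" "U \<times> V \<subseteq> W"
      by (rule openin_prod_topology_boxE[OF W(1)]) (use W(2) p in auto)
    obtain U' where U': "U' \<in> \<A>" "x \<in> U'" "U' \<subseteq> U" using A(3)[OF UV(1,3)] by auto
    obtain V' where V': "V' \<in> \<B>" "y \<in> V'" "V' \<subseteq> V" using B(3)[OF UV(2,4)] by auto
    have "U' \<times> V' \<in> ?C" using U'(1) V'(1) by auto
    moreover have "U' \<times> V' \<subseteq> W" using U'(3) V'(3) UV(5) by blast
    ultimately show ?thesis using U'(2) V'(2) p by (intro bexI[of _ "U' \<times> V'"]) auto
  qed
  moreover have "countable ?C" using A(1) B(1) by auto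
  moreover have "\<forall>C\<in>?C. openin (prod_topology X Y) C" using A(2) B(2) by (auto simp: openin_prod_Times_iff)
  ultimately show ?thesis unfolding second_countable_def by (intro exI[of _ ?C] conjI allI impI) auto
qed

text \<open>Diagonal arguments by contradiction pick one bad point in each \<open>W n\<close>; the last clause makes the picked
  points converge to \<open>x\<close>.\<close>

lemma metrizable_imp_converging_choices:
  assumes "metrizable_space X" "x \<in> topspace X"
  obtains W :: "nat \<Rightarrow> 'a set" where "\<And>n. openin X (W n)" "\<And>n. x \<in> W n"
    "\<And>s. (\<And>n. s n \<in> W n) \<Longrightarrow> limitin X s x sequentially"
proof -
  obtain M d where Md: "Metric_space M d" "X = Metric_space.mtopology M d"
    using assms(1) by (auto simp: metrizable_space_def)
  interpret Metric_space M d by (fact Md)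
  have x: "x \<in> M" using assms(2) Md(2) by simp
  define W where "W = (\<lambda>n. mball x (inverse (real (Suc n))))"
  have lim: "limitin X s x sequentially" if s: "\<And>n. s n \<in> W n" for s
    unfolding Md(2) limit_metric_sequentially
  proof (intro conjI allI impI x)
    fix e :: real assume "e > 0"
    then obtain N where N: "inverse (real (Suc N)) < e" using reals_Archimedean by blast
    show "\<exists>N. \<forall>n\<ge>N. s n \<in> M \<and> d (s n) x < e"
    proof (intro exI allI impI)
      fix n assume "N \<le> n"
      then have "inverse (real (Suc n)) \<le> inverse (real (Suc N))" by (simp add: le_imp_inverse_le)
      moreover have "s n \<in> M" "d (s n) x < inverse (real (Suc n))"
        using s[of n] by (auto simp: W_def commute)
      ultimately show "s n \<in> M \<and> d (s n) x < e" using N by linarith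
    qed
  qed
  show ?thesis by (rule that[of W]) (use x lim in \<open>auto simp: W_def Md(2)\<close>)
qed

lemma sequentially_continuous_imp_continuous_map:
  assumes "metrizable_space X" "f \<in> topspace X \<rightarrow> topspace Y"
    and seq: "\<And>(s :: nat \<Rightarrow> 'a) l. range s \<subseteq> topspace X \<Longrightarrow> limitin X s l sequentially \<Longrightarrow>
        limitin Y (f \<circ> s) (f l) sequentially"
  shows "continuous_map X Y f"
  unfolding continuous_map_eq_topcontinuous_at topcontinuous_at_def
proof (intro ballI conjI allI impI)
  fix x V assume x: "x \<in> topspace X" and V: "openin Y V \<and> f x \<in> V"
  obtain W :: "nat \<Rightarrow> 'a set" where W: "\<And>n. openin X (W n)" "\<And>n. x \<in> W n"
    "\<And>s. (\<And>n. s n \<in> W n) \<Longrightarrow> limitin X s x sequentially"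
    using metrizable_imp_converging_choices[OF assms(1) x] by blast
  show "\<exists>U. openin X U \<and> x \<in> U \<and> (\<forall>y\<in>U. f y \<in> V)"
  proof (rule ccontr)
    assume "\<not> ?thesis"
    then have "\<forall>n. \<exists>y. y \<in> W n \<and> f y \<notin> V" using W(1,2) by blast
    then obtain s where s: "\<And>n. s n \<in> W n" "\<And>n. f (s n) \<notin> V" by metis
    have "range s \<subseteq> topspace X" using s(1) W(1) openin_subset by blast
    then have "limitin Y (f \<circ> s) (f x) sequentially" using seq W(3)[OF s(1)] by blast
    then have "\<forall>\<^sub>F n in sequentially. f (s n) \<in> V" using V by (auto simp: limitin_def o_def)
    then show False using s(2) by simp
  qed
qed (use assms in auto)

section \<open>Continuity at a point\<close>

lemma topcontinuous_atD:
  assumes "topcontinuous_at X Y f x" "openin Y V" "f x \<in> V"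
  shows "\<exists>U. openin X U \<and> x \<in> U \<and> (\<forall>y\<in>U. f y \<in> V)"
  using assms unfolding topcontinuous_at_def by blast

lemma topcontinuous_at_compose_left:
  assumes "topcontinuous_at X Y f x" "continuous_map Y Z g"
  shows "topcontinuous_at X Z (g \<circ> f) x"
  unfolding topcontinuous_at_def
proof (intro conjI allI impI)
  fix V assume V: "openin Z V \<and> (g \<circ> f) x \<in> V"
  have "openin Y {y \<in> topspace Y. g y \<in> V}"
    using assms(2) V openin_continuous_map_preimage by blast
  moreover have "f x \<in> {y \<in> topspace Y. g y \<in> V}"
    using V assms(1) by (auto simp: topcontinuous_at_def)
  ultimately obtain U where "openin X U" "x \<in> U" "\<forall>u\<in>U. f u \<in> {y \<in> topspace Y. g y \<in> V}"
    using assms(1) unfolding topcontinuous_at_def by metis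
  then show "\<exists>U. openin X U \<and> x \<in> U \<and> (\<forall>y\<in>U. (g \<circ> f) y \<in> V)"
    by (intro exI[of _ U]) auto
next
  show "x \<in> topspace X" using assms by (simp add: topcontinuous_at_def)
  show "g \<circ> f \<in> topspace X \<rightarrow> topspace Z"
    using assms by (auto simp: topcontinuous_at_def continuous_map_def)
qed

lemma topcontinuous_at_compose_right:
  assumes "topcontinuous_at Y Z g (h x)" "continuous_map X Y h" "x \<in> topspace X"
  shows "topcontinuous_at X Z (g \<circ> h) x"
  unfolding topcontinuous_at_def
proof (intro conjI allI impI)
  fix V assume "openin Z V \<and> (g \<circ> h) x \<in> V"
  then obtain U where "openin Y U" "h x \<in> U" "\<forall>u\<in>U. g u \<in> V"
    using assms(1) unfolding topcontinuous_at_def by (metis comp_apply)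
  then show "\<exists>U. openin X U \<and> x \<in> U \<and> (\<forall>y\<in>U. (g \<circ> h) y \<in> V)"
    using assms(2,3) by (intro exI[of _ "{x \<in> topspace X. h x \<in> U}"]) (auto intro: openin_continuous_map_preimage)
next
  show "g \<circ> h \<in> topspace X \<rightarrow> topspace Z"
    using assms by (auto simp: topcontinuous_at_def continuous_map_def)
qed (use assms in auto)

lemma topcontinuous_at_open_subspace:
  assumes "openin X W" "topcontinuous_at (subtopology X W) Z f p" "f \<in> topspace X \<rightarrow> topspace Z"
  shows "topcontinuous_at X Z f p"
  unfolding topcontinuous_at_def
proof (intro conjI allI impI)
  fix V assume "openin Z V \<and> f p \<in> V"
  then obtain U where "openin (subtopology X W) U" "p \<in> U" "\<forall>u\<in>U. f u \<in> V"
    using assms(2) unfolding topcontinuous_at_def by metis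
  then show "\<exists>U. openin X U \<and> p \<in> U \<and> (\<forall>y\<in>U. f y \<in> V)"
    using assms(1) openin_trans_full by blast
qed (use assms in \<open>auto simp: topcontinuous_at_def\<close>)

lemma topcontinuous_at_subtopology:
  assumes "topcontinuous_at X Z f p" "f \<in> topspace X \<rightarrow> topspace (subtopology Z S)"
  shows "topcontinuous_at X (subtopology Z S) f p"
  unfolding topcontinuous_at_def
proof (intro conjI allI impI)
  show "p \<in> topspace X" using assms(1) by (simp add: topcontinuous_at_def)
  fix V assume V: "openin (subtopology Z S) V \<and> f p \<in> V"
  then obtain V' where V': "openin Z V'" "V = V' \<inter> S" unfolding openin_subtopology by blast
  then obtain U where U: "openin X U" "p \<in> U" "\<forall>q\<in>U. f q \<in> V'"
    using topcontinuous_atD[OF assms(1) V'(1)] V by blast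
  have "f q \<in> V" if "q \<in> U" for q
    using U that V'(2) assms(2) openin_subset[OF U(1)] by auto
  then show "\<exists>U. openin X U \<and> p \<in> U \<and> (\<forall>q\<in>U. f q \<in> V)" using U(1,2) by blast
qed (rule assms(2))

lemma topcontinuous_at_topology_generated_by:
  assumes "p \<in> topspace A" "f \<in> topspace A \<rightarrow> topspace (topology_generated_by \<S>)"
    and sub: "\<And>S. S \<in> \<S> \<Longrightarrow> f p \<in> S \<Longrightarrow> \<exists>U. openin A U \<and> p \<in> U \<and> (\<forall>q\<in>U. f q \<in> S)"
  shows "topcontinuous_at A (topology_generated_by \<S>) f p"
  unfolding topcontinuous_at_def
proof (intro conjI allI impI)
  fix V assume "openin (topology_generated_by \<S>) V \<and> f p \<in> V"
  then have "generate_topology_on \<S> V" "f p \<in> V" by (auto simp: openin_topology_generated_by_iff)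
  then show "\<exists>U. openin A U \<and> p \<in> U \<and> (\<forall>q\<in>U. f q \<in> V)"
  proof (induction rule: generate_topology_on.induct)
    case (Int a b)
    then obtain U U' where "openin A U" "p \<in> U" "\<forall>q\<in>U. f q \<in> a" "openin A U'" "p \<in> U'" "\<forall>q\<in>U'. f q \<in> b"
      by auto
    then show ?case by (intro exI[of _ "U \<inter> U'"]) (auto simp: openin_Int)
  next
    case (UN K)
    then obtain k where k: "k \<in> K" "f p \<in> k" by auto
    then obtain U where "openin A U" "p \<in> U" "\<forall>q\<in>U. f q \<in> k" using UN.IH[OF k] by auto
    then show ?case using k(1) by (intro exI[of _ U]) auto
  qed (use sub in auto)
qed (use assms in auto)

text \<open>As \<open>G\<close> is continuous only at the points over \<open>q\<close>, the preimage of \<open>U\<close> need not be open. The usual tube lemma is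
  applied to its interior \<open>W\<close> instead.\<close>

lemma tube_topcontinuous_at:
  assumes C: "compactin M C" and q: "q \<in> topspace A"
    and G: "\<And>m. m \<in> C \<Longrightarrow> topcontinuous_at (prod_topology A M) Y G (q, m)"
    and U: "openin Y U" "\<And>m. m \<in> C \<Longrightarrow> G (q, m) \<in> U"
  shows "\<exists>V. openin A V \<and> q \<in> V \<and> (\<forall>q'\<in>V. \<forall>m\<in>C. G (q', m) \<in> U)"
proof -
  define W where "W = \<Union>{W. openin (prod_topology A M) W \<and> (\<forall>r\<in>W. G r \<in> U)}"
  have oW: "openin (prod_topology A M) W" unfolding W_def by (intro openin_Union) auto
  have "{q} \<times> C \<subseteq> W"
  proof
    fix r assume "r \<in> {q} \<times> C"
    then obtain m where m: "m \<in> C" "r = (q, m)" by auto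
    obtain V where "openin (prod_topology A M) V" "(q, m) \<in> V" "\<forall>r\<in>V. G r \<in> U"
      using topcontinuous_atD[OF G[OF m(1)] U(1) U(2)[OF m(1)]] by auto
    then show "r \<in> W" using m(2) unfolding W_def by blast
  qed
  then obtain V V' where V: "openin A V" "q \<in> V" "C \<subseteq> V'" "V \<times> V' \<subseteq> W"
    using tube_lemma_right[OF oW C q] by auto
  have "G (q', m) \<in> U" if "q' \<in> V" "m \<in> C" for q' m
  proof -
    have "(q', m) \<in> W" using V(3,4) that by blast
    then show ?thesis unfolding W_def by blast
  qed
  then show ?thesis using V(1,2) by blast
qed

section \<open>Meager sets\<close>

lemma meager_in_countable_UN:
  assumes "countable I" "\<And>i. i \<in> I \<Longrightarrow> meager_in X (A i)"
  shows "meager_in X (\<Union>i\<in>I. A i)"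
proof -
  have "\<forall>i\<in>I. \<exists>\<N>. countable \<N> \<and> (\<forall>N\<in>\<N>. nowhere_dense_in X N) \<and> A i = \<Union>\<N>"
    using assms(2) by (auto simp: meager_in_def)
  then obtain \<N> where N: "\<forall>i\<in>I. countable (\<N> i) \<and> (\<forall>N\<in>\<N> i. nowhere_dense_in X N) \<and> A i = \<Union>(\<N> i)"
    by metis
  then show ?thesis unfolding meager_in_def using assms(1)
    by (intro exI[of _ "\<Union>i\<in>I. \<N> i"]) auto
qed

lemma meager_in_Un:
  assumes "meager_in X A" "meager_in X B"
  shows "meager_in X (A \<union> B)"
proof -
  have "A \<union> B = (\<Union>i\<in>{A, B}. i)" by auto
  then show ?thesis using assms meager_in_countable_UN[of "{A, B}" X "\<lambda>i. i"] by auto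
qed

text \<open>A nonempty open subset of the closure of \<open>N \<subseteq> U\<close> meets \<open>N\<close>, hence meets \<open>U\<close> in a nonempty open subset
  of \<open>U\<close>. So a set that is nowhere dense in \<open>U\<close> is nowhere dense in the whole space.\<close>

lemma meager_in_open_subspace:
  assumes U: "openin X U" and A: "meager_in (subtopology X U) A"
  shows "meager_in X A"
proof -
  have "nowhere_dense_in X N" if N: "nowhere_dense_in (subtopology X U) N" for N
  proof -
    have NU: "N \<subseteq> U" "N \<subseteq> topspace X" using N by (auto simp: nowhere_dense_in_def)
    have "W = {}" if W: "openin X W" "W \<subseteq> X closure_of N" for W
    proof (rule ccontr)
      assume "W \<noteq> {}"
      then have "W \<inter> N \<noteq> {}" using W openin_Int_closure_of_eq_empty[OF W(1)] by blast
      moreover have "openin (subtopology X U) (W \<inter> U)" using W(1) by (rule openin_subtopology_Int)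
      moreover have "W \<inter> U \<subseteq> subtopology X U closure_of N"
        using W(2) NU(1) by (auto simp: closure_of_subtopology Int_absorb1)
      ultimately show False
        using N NU(1) interior_of_maximal[of "W \<inter> U"] unfolding nowhere_dense_in_def by blast
    qed
    from this[OF openin_interior_of interior_of_subset] show ?thesis
      using NU(2) unfolding nowhere_dense_in_def by simp
  qed
  then show ?thesis using A unfolding meager_in_def by blast
qed

text \<open>Apart from those supplied by the given \<open>CC\<close>-Maslyuchenko spaces, all exceptional sets below arise from
  countably many closed sets in this way: a closed set without its interior is closed and has empty interior.\<close>

lemma meager_in_boundaries:
  assumes "countable \<F>" "\<And>F. F \<in> \<F> \<Longrightarrow> closedin X F"
  shows "meager_in X (\<Union>F\<in>\<F>. F - X interior_of F)"
proof -
  have "nowhere_dense_in X (F - X interior_of F)" if "closedin X F" for F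
  proof -
    have cl: "closedin X (F - X interior_of F)" using that openin_interior_of by blast
    have "X interior_of (F - X interior_of F) \<subseteq> X interior_of F" by (rule interior_of_mono) auto
    then have "X interior_of (F - X interior_of F) = {}"
      using interior_of_subset[of X "F - X interior_of F"] by blast
    then show ?thesis
      using cl closedin_subset unfolding nowhere_dense_in_def by (metis closure_of_closedin)
  qed
  then show ?thesis unfolding meager_in_def using assms
    by (intro exI[of _ "(\<lambda>F. F - X interior_of F) ` \<F>"]) auto
qed

lemma image_subset_UN: "D \<subseteq> (\<Union>i\<in>I. E i) \<Longrightarrow> h ` D \<subseteq> (\<Union>i\<in>I. h ` E i)"
  by blast

section \<open>Separately continuous maps and closed pieces of the target\<close>

lemma separately_continuousD:
  assumes "separately_continuous X Y Z f"
  shows "x \<in> topspace X \<Longrightarrow> continuous_map Y Z (\<lambda>y. f (x, y))"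
    "y \<in> topspace Y \<Longrightarrow> continuous_map X Z (\<lambda>x. f (x, y))"
    "f \<in> topspace (prod_topology X Y) \<rightarrow> topspace Z"
proof -
  show "x \<in> topspace X \<Longrightarrow> continuous_map Y Z (\<lambda>y. f (x, y))"
    "y \<in> topspace Y \<Longrightarrow> continuous_map X Z (\<lambda>x. f (x, y))"
    using assms by (auto simp: separately_continuous_def)
  show "f \<in> topspace (prod_topology X Y) \<rightarrow> topspace Z"
    
  proof
    fix p assume "p \<in> topspace (prod_topology X Y)"
    then obtain x y where "p = (x, y)" "x \<in> topspace X" "y \<in> topspace Y" by auto
    then show "f p \<in> topspace Z" using assms by (auto simp: separately_continuous_def continuous_map_def)
  qed
qed

lemma separately_continuous_compose:
  assumes "separately_continuous X Y Z f" "continuous_map Z W h"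
  shows "separately_continuous X Y W (h \<circ> f)"
  unfolding separately_continuous_def
proof (intro conjI ballI)
  show "continuous_map Y W (\<lambda>y. (h \<circ> f) (x, y))" if "x \<in> topspace X" for x
    using continuous_map_compose[OF separately_continuousD(1)[OF assms(1) that] assms(2)]
    by (simp add: o_def)
  show "continuous_map X W (\<lambda>x. (h \<circ> f) (x, y))" if "y \<in> topspace Y" for y
    using continuous_map_compose[OF separately_continuousD(2)[OF assms(1) that] assms(2)]
    by (simp add: o_def)
qed

lemma separately_continuous_on_box:
  assumes "separately_continuous X Y Z f" "f ` (U \<times> V) \<subseteq> T"
  shows "separately_continuous (subtopology X U) (subtopology Y V) (subtopology Z T) f"
  unfolding separately_continuous_def
proof (intro conjI ballI)
  show "continuous_map (subtopology Y V) (subtopology Z T) (\<lambda>y. f (x, y))"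
    if "x \<in> topspace (subtopology X U)" for x
    using assms(2) that
      continuous_map_from_subtopology[OF separately_continuousD(1)[OF assms(1), of x], of V]
    by (simp add: continuous_map_in_subtopology image_subset_iff)
  show "continuous_map (subtopology X U) (subtopology Z T) (\<lambda>x. f (x, y))"
    if "y \<in> topspace (subtopology Y V)" for y
    using assms(2) that
      continuous_map_from_subtopology[OF separately_continuousD(2)[OF assms(1), of y], of U]
    by (simp add: continuous_map_in_subtopology image_subset_iff)
qed

text \<open>The condition is symmetric in the two factors: exchanging the variables of \<open>f\<close> turns the projection on
  \<open>Y\<close> into a projection on the first factor. All the constructions below therefore treat the first
  projection only. Second countability replaces separability because it passes to subspaces.\<close>

lemma CC_MaslyuchenkoI:
  fixes Z :: "'z topology"
  assumes "\<And>(X :: (nat \<Rightarrow> real) topology) (Y :: (nat \<Rightarrow> real) topology) f.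
      \<lbrakk>second_countable X; metrizable_space X; second_countable Y; metrizable_space Y;
       separately_continuous X Y Z f\<rbrakk>
      \<Longrightarrow> meager_in X (fst ` disc_points (prod_topology X Y) Z f)"
  shows "CC_Maslyuchenko Z"
  unfolding CC_Maslyuchenko_def
proof (intro allI impI, elim conjE)
  fix X Y :: "(nat \<Rightarrow> real) topology" and f
  assume "separable_space X" "metrizable_space X" "separable_space Y" "metrizable_space Y"
    and f: "separately_continuous X Y Z f"
  then have X: "second_countable X" "metrizable_space X" and Y: "second_countable Y" "metrizable_space Y"
    using separable_metrizable_imp_second_countable by auto
  let ?s = "\<lambda>(x, y). (y, x)"
  have s: "separately_continuous Y X Z (f \<circ> ?s)"
    using f by (auto simp: separately_continuous_def)
  have "snd ` disc_points (prod_topology X Y) Z f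
      \<subseteq> fst ` disc_points (prod_topology Y X) Z (f \<circ> ?s)"
  proof
    fix y assume "y \<in> snd ` disc_points (prod_topology X Y) Z f"
    then obtain x where xy: "(x, y) \<in> disc_points (prod_topology X Y) Z f" by force
    have "(y, x) \<in> disc_points (prod_topology Y X) Z (f \<circ> ?s)"
    proof (rule ccontr)
      assume "\<not> ?thesis"
      then have "topcontinuous_at (prod_topology Y X) Z (f \<circ> ?s) (?s (x, y))"
        using xy by (simp add: disc_points_def)
      moreover have "continuous_map (prod_topology X Y) (prod_topology Y X) ?s"
        by (simp add: case_prod_unfold continuous_map_paired continuous_map_fst continuous_map_snd)
      ultimately have "topcontinuous_at (prod_topology X Y) Z ((f \<circ> ?s) \<circ> ?s) (x, y)"
        using topcontinuous_at_compose_right[of "prod_topology Y X" Z "f \<circ> ?s" ?s "(x, y)" "prod_topology X Y"] xy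
        by (simp add: disc_points_def)
      moreover have "(f \<circ> ?s) \<circ> ?s = f" by auto
      ultimately show False using xy by (simp add: disc_points_def)
    qed
    then show "y \<in> fst ` disc_points (prod_topology Y X) Z (f \<circ> ?s)" by force
  qed
  then show "meager_in X (fst ` disc_points (prod_topology X Y) Z f) \<and>
      meager_in Y (snd ` disc_points (prod_topology X Y) Z f)"
    using assms[OF X Y f] meager_in_subset[OF assms[OF Y X s]] by simp
qed

lemma CC_meager_disc:
  assumes "CC_Maslyuchenko Z" "second_countable X" "metrizable_space X"
    "second_countable Y" "metrizable_space Y" "separately_continuous X Y Z f"
  shows "meager_in X (fst ` disc_points (prod_topology X Y) Z f)"
  using CC_MaslyuchenkoD(1)[OF assms(1) second_countable_imp_separable_space[OF assms(2)] assms(3)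
      second_countable_imp_separable_space[OF assms(4)] assms(5,6)] .

text \<open>On an open box that \<open>f\<close> maps into \<open>T\<close>, a continuous \<open>h : T \<rightarrow> W\<close> produces a separately continuous map into \<open>W\<close>.
  The freedom in \<open>h\<close> is there for the retractions in the retral unions.\<close>

lemma CC_meager_disc_on_box:
  assumes W: "CC_Maslyuchenko W" and X: "second_countable X" "metrizable_space X"
    and Y: "second_countable Y" "metrizable_space Y"
    and f: "separately_continuous X Y Z f" and h: "continuous_map (subtopology Z T) W h"
    and UV: "openin X U" "openin Y V" "f ` (U \<times> V) \<subseteq> T"
  shows "meager_in X (fst ` disc_points (subtopology (prod_topology X Y) (U \<times> V)) W (h \<circ> f))"
proof -
  have "separately_continuous (subtopology X U) (subtopology Y V) W (h \<circ> f)"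
    using separately_continuous_compose[OF separately_continuous_on_box[OF f UV(3)] h] .
  then have "meager_in (subtopology X U)
      (fst ` disc_points (prod_topology (subtopology X U) (subtopology Y V)) W (h \<circ> f))"
    by (intro CC_meager_disc W second_countable_subtopology metrizable_space_subtopology X Y)
  then show ?thesis
    using meager_in_open_subspace[OF UV(1)] by (simp add: subtopology_Times)
qed

lemma CC_piece_meager_disc_on_box:
  assumes T: "CC_Maslyuchenko (subtopology Z T)"
    and X: "second_countable X" "metrizable_space X" and Y: "second_countable Y" "metrizable_space Y"
    and f: "separately_continuous X Y Z f"
    and UV: "openin X U" "openin Y V" "f ` (U \<times> V) \<subseteq> T"
  shows "meager_in X (fst ` (disc_points (prod_topology X Y) Z f \<inter> U \<times> V))"
proof (rule meager_in_subset[OF CC_meager_disc_on_box[OF T X Y f _ UV, of id]])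
  have o: "openin (prod_topology X Y) (U \<times> V)" using UV by (simp add: openin_prod_Times_iff)
  have "p \<in> disc_points (subtopology (prod_topology X Y) (U \<times> V)) (subtopology Z T) f"
    if p: "p \<in> disc_points (prod_topology X Y) Z f" "p \<in> U \<times> V" for p
  proof -
    have "topcontinuous_at (prod_topology X Y) Z f p"
      if "topcontinuous_at (subtopology (prod_topology X Y) (U \<times> V)) (subtopology Z T) f p"
      using topcontinuous_at_compose_left[OF that, of Z id]
        topcontinuous_at_open_subspace[OF o] separately_continuousD(3)[OF f]
      by (simp add: continuous_map_from_subtopology)
    then show ?thesis using p by (auto simp: disc_points_def)
  qed
  then show "fst ` (disc_points (prod_topology X Y) Z f \<inter> U \<times> V)
      \<subseteq> fst ` disc_points (subtopology (prod_topology X Y) (U \<times> V)) (subtopology Z T) (id \<circ> f)"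
    by auto
qed simp

text \<open>From a vertical to a two-dimensional neighborhood. Suppose that for \<open>(x, y) \<in> E\<close> some vertical segment
  \<open>{x} \<times> V\<close> is mapped into the closed set \<open>T\<close>; here \<open>V\<close> may be taken from a countable base. By continuity in
  the first variable the set \<open>F V\<close> of those \<open>x\<close> for which \<open>f\<close> maps \<open>{x} \<times> V\<close> into \<open>T\<close> is closed. Unless \<open>x\<close> is on
  the boundary of one of these countably many closed sets, a whole box around \<open>(x, y)\<close> is mapped into \<open>T\<close>. So it is
  enough to control \<open>E\<close> on boxes that are mapped into \<open>T\<close>.\<close>

lemma meager_projection_of_closed_piece:
  assumes Y: "second_countable Y" and f: "separately_continuous X Y Z f" and T: "closedin Z T"
    and vert: "\<And>x y. (x, y) \<in> E \<Longrightarrow>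
      x \<in> topspace X \<and> (\<exists>V. openin Y V \<and> y \<in> V \<and> f ` ({x} \<times> V) \<subseteq> T)"
    and box: "\<And>U V. \<lbrakk>openin X U; openin Y V; f ` (U \<times> V) \<subseteq> T\<rbrakk> \<Longrightarrow> meager_in X (fst ` (E \<inter> U \<times> V))"
  shows "meager_in X (fst ` E)"
proof -
  obtain \<B> where \<B>: "countable \<B>" "\<And>V. V \<in> \<B> \<Longrightarrow> openin Y V"
    "\<And>U y. openin Y U \<Longrightarrow> y \<in> U \<Longrightarrow> \<exists>V\<in>\<B>. y \<in> V \<and> V \<subseteq> U"
    using Y by (auto simp: second_countable_def)
  define F where "F V = {x \<in> topspace X. f ` ({x} \<times> V) \<subseteq> T}" for V
  have clF: "closedin X (F V)" if "V \<in> \<B>" for V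
  proof -
    have "topspace X - F V = (\<Union>y\<in>V. topspace X - {x \<in> topspace X. f (x, y) \<in> T})"
      by (auto simp: F_def)
    moreover have "openin X (topspace X - {x \<in> topspace X. f (x, y) \<in> T})" if "y \<in> V" for y
    proof -
      have "y \<in> topspace Y" using that \<B>(2)[OF \<open>V \<in> \<B>\<close>] openin_subset by blast
      then show ?thesis
        using closedin_continuous_map_preimage[OF separately_continuousD(2)[OF f] T] by blast
    qed
    ultimately have "openin X (topspace X - F V)" by (metis (no_types, lifting) openin_clauses(3) imageE)
    then show ?thesis by (auto simp: closedin_def F_def)
  qed
  let ?N = "(\<Union>A\<in>F ` \<B>. A - X interior_of A) \<union> (\<Union>V\<in>\<B>. fst ` (E \<inter> (X interior_of F V) \<times> V))"
  have "meager_in X ?N"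
  proof (intro meager_in_Un meager_in_boundaries meager_in_countable_UN)
    fix V assume V: "V \<in> \<B>"
    have "f ` ((X interior_of F V) \<times> V) \<subseteq> T"
      using interior_of_subset[of X "F V"] by (force simp: F_def)
    then show "meager_in X (fst ` (E \<inter> (X interior_of F V) \<times> V))"
      using box[of "X interior_of F V" V] \<B>(2)[OF V] by simp
  qed (use \<B> clF in auto)
  moreover have "fst ` E \<subseteq> ?N"
  proof
    fix x assume "x \<in> fst ` E"
    then obtain y where xy: "(x, y) \<in> E" by force
    then obtain V where "openin Y V" "y \<in> V" "f ` ({x} \<times> V) \<subseteq> T" using vert by blast
    then obtain B where B: "B \<in> \<B>" "y \<in> B" "f ` ({x} \<times> B) \<subseteq> T" using \<B>(3)[of V y] by fastforce
    then have xF: "x \<in> F B" using vert[OF xy] by (auto simp: F_def)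
    show "x \<in> ?N"
    proof (cases "x \<in> X interior_of F B")
      case True
      then have "x \<in> fst ` (E \<inter> (X interior_of F B) \<times> B)" using xy B(2) by force
      then show ?thesis using B(1) by (intro UnI2 UN_I[of B])
    next
      case False
      then show ?thesis using B(1) xF by (intro UnI1 UN_I[of "F B"]) auto
    qed
  qed
  ultimately show ?thesis by (rule meager_in_subset)
qed

lemma meager_projection_of_CC_piece:
  assumes "second_countable X" "metrizable_space X" "second_countable Y" "metrizable_space Y"
    and f: "separately_continuous X Y Z f"
    and T: "closedin Z T" "CC_Maslyuchenko (subtopology Z T)"
    and E: "E \<subseteq> disc_points (prod_topology X Y) Z f"
      "\<And>x y. (x, y) \<in> E \<Longrightarrow> \<exists>V. openin Y V \<and> y \<in> V \<and> f ` ({x} \<times> V) \<subseteq> T"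
  shows "meager_in X (fst ` E)"
proof (rule meager_projection_of_closed_piece[OF assms(3) f T(1)])
  show "x \<in> topspace X \<and> (\<exists>V. openin Y V \<and> y \<in> V \<and> f ` ({x} \<times> V) \<subseteq> T)" if "(x, y) \<in> E" for x y
    using E(1) E(2)[OF that] that by (auto simp: disc_points_def)
  show "meager_in X (fst ` (E \<inter> U \<times> V))" if UV: "openin X U" "openin Y V" "f ` (U \<times> V) \<subseteq> T" for U V
    by (rule meager_in_subset[OF CC_piece_meager_disc_on_box[OF T(2) assms(1-4) f UV]]) (use E(1) in auto)
qed

section \<open>Metrizable spaces\<close>

text \<open>The classical argument. Let \<open>F V n\<close> consist of those \<open>x\<close> for which the section \<open>f (x, \<cdot>)\<close> oscillates by at most
  \<open>1 / (n + 1)\<close> on \<open>V\<close>; this is a closed set. If \<open>x\<close> avoids the boundaries of all \<open>F V n\<close>, \<open>V\<close> in a countable base,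
  then the oscillation bound that continuity of \<open>f (x, \<cdot>)\<close> gives near \<open>y\<close> persists for all \<open>x'\<close> close to \<open>x\<close>,
  and \<open>f (x', y')\<close> is close to \<open>f (x', y)\<close>, which is close to \<open>f (x, y)\<close>.\<close>

lemma metrizable_imp_CC_Maslyuchenko:
  assumes "metrizable_space Z"
  shows "CC_Maslyuchenko Z"
proof (rule CC_MaslyuchenkoI)
  fix X Y :: "(nat \<Rightarrow> real) topology" and f
  assume Y: "second_countable Y" and f: "separately_continuous X Y Z f"
  obtain M d where Md: "Metric_space M d" "Z = Metric_space.mtopology M d"
    using assms by (auto simp: metrizable_space_def)
  interpret Metric_space M d by (fact Md)
  obtain \<B> where \<B>: "countable \<B>" "\<And>V. V \<in> \<B> \<Longrightarrow> openin Y V"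
    "\<And>U y. openin Y U \<Longrightarrow> y \<in> U \<Longrightarrow> \<exists>V\<in>\<B>. y \<in> V \<and> V \<subseteq> U"
    using Y by (auto simp: second_countable_def)
  have fM: "f (x, y) \<in> M" if "x \<in> topspace X" "y \<in> topspace Y" for x y
    using separately_continuousD(3)[OF f] that Md(2) by auto
  have ex: "\<exists>V. openin Y V \<and> y \<in> V \<and> (\<forall>y'\<in>V. d (f (x, y)) (f (x, y')) < e)"
    if "x \<in> topspace X" "y \<in> topspace Y" "e > 0" for x y e
  proof -
    have "openin Z (mball (f (x, y)) e)" using Md(2) by simp
    then have "openin Y {y' \<in> topspace Y. f (x, y') \<in> mball (f (x, y)) e}"
      using separately_continuousD(1)[OF f that(1)] by (rule openin_continuous_map_preimage[rotated])
    then show ?thesis using that fM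
      by (intro exI[of _ "{y' \<in> topspace Y. f (x, y') \<in> mball (f (x, y)) e}"]) auto
  qed
  have ey: "\<exists>U. openin X U \<and> x \<in> U \<and> (\<forall>x'\<in>U. d (f (x, y)) (f (x', y)) < e)"
    if "x \<in> topspace X" "y \<in> topspace Y" "e > 0" for x y e
  proof -
    have "openin Z (mball (f (x, y)) e)" using Md(2) by simp
    then have "openin X {x' \<in> topspace X. f (x', y) \<in> mball (f (x, y)) e}"
      using separately_continuousD(2)[OF f that(2)] by (rule openin_continuous_map_preimage[rotated])
    then show ?thesis using that fM
      by (intro exI[of _ "{x' \<in> topspace X. f (x', y) \<in> mball (f (x, y)) e}"]) auto
  qed
  define F where "F V n = {x \<in> topspace X. \<forall>y\<in>V. \<forall>y'\<in>V. d (f (x, y)) (f (x, y')) \<le> inverse (Suc n)}"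
    for V and n :: nat
  have clF: "closedin X (F V n)" if V: "V \<in> \<B>" for V n
  proof -
    let ?c = "inverse (real (Suc n))"
    have VY: "V \<subseteq> topspace Y" using \<B>(2)[OF V] openin_subset by blast
    have "\<exists>U. openin X U \<and> x \<in> U \<and> U \<subseteq> topspace X - F V n" if x: "x \<in> topspace X - F V n" for x
    proof -
      obtain y y' where y: "y \<in> V" "y' \<in> V" "d (f (x, y)) (f (x, y')) > ?c"
        using x by (auto simp: F_def not_le)
      \<comment> \<open>Moving both ends of an oscillation above \<open>?c\<close> by less than half the surplus keeps it above \<open>?c\<close>.\<close>
      define e where "e = (d (f (x, y)) (f (x, y')) - ?c) / 2"
      have e: "e > 0" using y(3) by (simp add: e_def)
      have yY: "y \<in> topspace Y" "y' \<in> topspace Y" using y(1,2) VY by auto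
      obtain U where U: "openin X U" "x \<in> U" "\<forall>x'\<in>U. d (f (x, y)) (f (x', y)) < e"
        using ey[of x y e] x yY(1) e by auto
      obtain U' where U': "openin X U'" "x \<in> U'" "\<forall>x'\<in>U'. d (f (x, y')) (f (x', y')) < e"
        using ey[of x y' e] x yY(2) e by auto
      have "z \<notin> F V n" if z: "z \<in> U \<inter> U'" for z
      proof -
        have zX: "z \<in> topspace X" using z U(1) openin_subset by blast
        have "d (f (x, y)) (f (x, y')) \<le> d (f (x, y)) (f (z, y)) + d (f (z, y)) (f (x, y'))"
          "d (f (z, y)) (f (x, y')) \<le> d (f (z, y)) (f (z, y')) + d (f (z, y')) (f (x, y'))"
          using fM x zX yY by (auto intro!: triangle)
        moreover have "d (f (x, y)) (f (z, y)) < e" "d (f (z, y')) (f (x, y')) < e"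
          using U(3) U'(3) z by (auto simp: commute)
        ultimately have "d (f (z, y)) (f (z, y')) > d (f (x, y)) (f (x, y')) - 2 * e" by linarith
        moreover have "a - 2 * ((a - c) / 2) = c" for a c :: real by (simp add: field_simps)
        then have "d (f (x, y)) (f (x, y')) - 2 * e = ?c" unfolding e_def .
        ultimately have "\<not> d (f (z, y)) (f (z, y')) \<le> ?c" by linarith
        then show ?thesis using y(1,2) by (auto simp: F_def)
      qed
      moreover have "U \<inter> U' \<subseteq> topspace X" using U(1) openin_subset by blast
      ultimately show ?thesis using U(1,2) U'(1,2) by (intro exI[of _ "U \<inter> U'"]) auto
    qed
    then have "openin X (topspace X - F V n)" by (subst openin_subopen) blast
    then show ?thesis by (auto simp: closedin_def F_def)
  qed
  let ?\<F> = "(\<lambda>(V, n). F V n) ` (\<B> \<times> UNIV)"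
  have "meager_in X (\<Union>A\<in>?\<F>. A - X interior_of A)"
    using \<B>(1) clF by (intro meager_in_boundaries) auto
  moreover have "fst ` disc_points (prod_topology X Y) Z f \<subseteq> (\<Union>A\<in>?\<F>. A - X interior_of A)"
  proof
    fix x assume "x \<in> fst ` disc_points (prod_topology X Y) Z f"
    then obtain y where D: "(x, y) \<in> disc_points (prod_topology X Y) Z f" by force
    then have x: "x \<in> topspace X" and y: "y \<in> topspace Y" by (auto simp: disc_points_def)
    show "x \<in> (\<Union>A\<in>?\<F>. A - X interior_of A)"
    proof (rule ccontr)
      assume no: "\<not> ?thesis"
      have "topcontinuous_at (prod_topology X Y) Z f (x, y)"
        unfolding topcontinuous_at_def
      proof (intro conjI allI impI)
        fix O' assume "openin Z O' \<and> f (x, y) \<in> O'"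
        then obtain e where e: "e > 0" "mball (f (x, y)) e \<subseteq> O'"
          unfolding Md(2) openin_mtopology by blast
        obtain n where n: "inverse (real (Suc n)) < e / 2"
          using e(1) reals_Archimedean[of "e / 2"] by auto
        obtain V where V: "openin Y V" "y \<in> V" "\<forall>y'\<in>V. d (f (x, y)) (f (x, y')) < inverse (real (Suc n)) / 2"
          using ex[OF x y, of "inverse (real (Suc n)) / 2"] by auto
        obtain B where B: "B \<in> \<B>" "y \<in> B" "B \<subseteq> V" using \<B>(3)[OF V(1,2)] by blast
        have BY: "B \<subseteq> topspace Y" using \<B>(2)[OF B(1)] openin_subset by blast
        have "d (f (x, u)) (f (x, v)) \<le> inverse (Suc n)" if "u \<in> B" "v \<in> B" for u v
        proof -
          have "d (f (x, u)) (f (x, v)) \<le> d (f (x, u)) (f (x, y)) + d (f (x, y)) (f (x, v))"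
            using fM x y that BY by (intro triangle) auto
          moreover have "d (f (x, u)) (f (x, y)) < inverse (real (Suc n)) / 2"
            "d (f (x, y)) (f (x, v)) < inverse (real (Suc n)) / 2"
            using V(3) B(3) that by (auto simp: commute)
          ultimately show ?thesis by linarith
        qed
        then have "x \<in> F B n" using x by (auto simp: F_def)
        then have xi: "x \<in> X interior_of F B n" using no B(1) by auto
        obtain U where U: "openin X U" "x \<in> U" "\<forall>x'\<in>U. d (f (x, y)) (f (x', y)) < e / 2"
          using ey[OF x y, of "e / 2"] e(1) by auto
        let ?W = "(U \<inter> X interior_of F B n) \<times> B"
        have "f p \<in> O'" if p: "p \<in> ?W" for p
        proof -
          obtain a b where ab: "p = (a, b)" "a \<in> U" "a \<in> F B n" "b \<in> B"
            using p interior_of_subset[of X "F B n"] by auto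
          have aX: "a \<in> topspace X" using ab(3) by (auto simp: F_def)
          have "d (f (x, y)) (f (a, b)) \<le> d (f (x, y)) (f (a, y)) + d (f (a, y)) (f (a, b))"
            using fM x y aX BY ab(4) by (intro triangle) auto
          moreover have "d (f (a, y)) (f (a, b)) \<le> inverse (Suc n)"
            using ab B(2) by (auto simp: F_def)
          ultimately have "d (f (x, y)) (f (a, b)) < e" using U(3) ab(2) n by fastforce
          then have "f (a, b) \<in> mball (f (x, y)) e" using fM x y aX BY ab(4) by auto
          then show ?thesis using e(2) ab(1) by blast
        qed
        moreover have "openin (prod_topology X Y) ?W"
          using U(1) \<B>(2)[OF B(1)] by (simp add: openin_prod_Times_iff openin_Int)
        ultimately show "\<exists>W. openin (prod_topology X Y) W \<and> (x, y) \<in> W \<and> (\<forall>p\<in>W. f p \<in> O')"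
          using U(2) xi B(2) by (intro exI[of _ ?W]) auto
      qed (use x y separately_continuousD(3)[OF f] in auto)
      then show False using D by (simp add: disc_points_def)
    qed
  qed
  ultimately show "meager_in X (fst ` disc_points (prod_topology X Y) Z f)" by (rule meager_in_subset)
qed

section \<open>Subspaces, homeomorphic images and products\<close>

lemma CC_Maslyuchenko_subtopology:
  assumes "CC_Maslyuchenko Z"
  shows "CC_Maslyuchenko (subtopology Z S)"
proof (rule CC_MaslyuchenkoI)
  fix X Y :: "(nat \<Rightarrow> real) topology" and f
  assume X: "second_countable X" "metrizable_space X" and Y: "second_countable Y" "metrizable_space Y"
    and f: "separately_continuous X Y (subtopology Z S) f"
  have fZ: "separately_continuous X Y Z f"
    using f by (simp add: separately_continuous_def continuous_map_in_subtopology)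
  have "disc_points (prod_topology X Y) (subtopology Z S) f \<subseteq> disc_points (prod_topology X Y) Z f"
    using topcontinuous_at_subtopology[OF _ separately_continuousD(3)[OF f]]
    by (auto simp: disc_points_def)
  then have "fst ` disc_points (prod_topology X Y) (subtopology Z S) f
      \<subseteq> fst ` disc_points (prod_topology X Y) Z f"
    by (rule image_mono)
  then show "meager_in X (fst ` disc_points (prod_topology X Y) (subtopology Z S) f)"
    using meager_in_subset[OF CC_meager_disc[OF assms X Y fZ]] by simp
qed

lemma CC_Maslyuchenko_homeomorphic:
  assumes "CC_Maslyuchenko Z" "Z homeomorphic_space W"
  shows "CC_Maslyuchenko W"
proof (rule CC_MaslyuchenkoI)
  fix X Y :: "(nat \<Rightarrow> real) topology" and f
  assume X: "second_countable X" "metrizable_space X" and Y: "second_countable Y" "metrizable_space Y"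
    and f: "separately_continuous X Y W f"
  obtain g h where gh: "continuous_map Z W g" "continuous_map W Z h"
    "\<And>w. w \<in> topspace W \<Longrightarrow> g (h w) = w"
    using assms(2) unfolding homeomorphic_space_def homeomorphic_maps_def by blast
  have hf: "separately_continuous X Y Z (h \<circ> f)" by (rule separately_continuous_compose[OF f gh(2)])
  have "p \<in> disc_points (prod_topology X Y) Z (h \<circ> f)"
    if p: "p \<in> disc_points (prod_topology X Y) W f" for p
  proof (rule ccontr)
    assume "\<not> ?thesis"
    then have "topcontinuous_at (prod_topology X Y) W (g \<circ> (h \<circ> f)) p"
      using p topcontinuous_at_compose_left[OF _ gh(1)] by (auto simp: disc_points_def)
    moreover have "(g \<circ> (h \<circ> f)) q = f q" if "q \<in> topspace (prod_topology X Y)" for q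
      using separately_continuousD(3)[OF f] gh(3) that by auto
    ultimately have "topcontinuous_at (prod_topology X Y) W f p"
      unfolding topcontinuous_at_def by (smt (verit, best) Pi_cong openin_subset subsetD)
    then show False using p by (simp add: disc_points_def)
  qed
  then have "fst ` disc_points (prod_topology X Y) W f
      \<subseteq> fst ` disc_points (prod_topology X Y) Z (h \<circ> f)"
    by (intro image_mono) blast
  then show "meager_in X (fst ` disc_points (prod_topology X Y) W f)"
    by (rule meager_in_subset[OF CC_meager_disc[OF assms(1) X Y hf]])
qed

text \<open>Continuity at a point into a product is coordinatewise, so the discontinuity points are the countable
  union of those of the coordinates.\<close>

lemma CC_Maslyuchenko_product:
  assumes "countable I" and Z: "\<And>i. i \<in> I \<Longrightarrow> CC_Maslyuchenko (Z i)"
  shows "CC_Maslyuchenko (product_topology Z I)"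
proof (rule CC_MaslyuchenkoI)
  fix X Y :: "(nat \<Rightarrow> real) topology" and f
  assume X: "second_countable X" "metrizable_space X" and Y: "second_countable Y" "metrizable_space Y"
    and f: "separately_continuous X Y (product_topology Z I) f"
  let ?D = "\<lambda>i. disc_points (prod_topology X Y) (Z i) ((\<lambda>z. z i) \<circ> f)"
  have "meager_in X (\<Union>i\<in>I. fst ` ?D i)"
    using assms(1) by (intro meager_in_countable_UN CC_meager_disc[OF Z X Y]
      separately_continuous_compose[OF f] continuous_map_product_projection)
  moreover have "disc_points (prod_topology X Y) (product_topology Z I) f \<subseteq> (\<Union>i\<in>I. ?D i)"
  proof
    fix p assume p: "p \<in> disc_points (prod_topology X Y) (product_topology Z I) f"
    let ?X = "prod_topology X Y"
    have pT: "p \<in> topspace ?X" using p by (simp add: disc_points_def)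
    have fT: "f \<in> topspace ?X \<rightarrow> topspace (product_topology Z I)"
      by (rule separately_continuousD(3)[OF f])
    show "p \<in> (\<Union>i\<in>I. ?D i)"
    proof (rule ccontr)
      assume "\<not> ?thesis"
      then have "\<forall>i\<in>I. limitin (Z i) (\<lambda>q. f q i) (f p i) (atin ?X p)"
        using pT by (auto simp: disc_points_def topcontinuous_at_atin o_def)
      moreover have "eventually (\<lambda>q. f q \<in> topspace (product_topology Z I)) (atin ?X p)"
        unfolding eventually_atin using pT fT
        by (intro disjI2 exI[of _ "topspace ?X"] conjI openin_topspace) auto
      moreover have "f p \<in> extensional I" using pT fT by (auto simp: PiE_iff)
      ultimately have "topcontinuous_at ?X (product_topology Z I) f p"
        using pT fT by (simp add: topcontinuous_at_atin limitin_componentwise)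
      then show False using p by (simp add: disc_points_def)
    qed
  qed
  then have "fst ` disc_points (prod_topology X Y) (product_topology Z I) f \<subseteq> (\<Union>i\<in>I. fst ` ?D i)"
    by (rule image_subset_UN)
  ultimately show "meager_in X (fst ` disc_points (prod_topology X Y) (product_topology Z I) f)"
    by (rule meager_in_subset)
qed

section \<open>Fibered preimages\<close>

text \<open>Where \<open>\<phi> \<circ> f\<close> is continuous, a basic box is mapped by \<open>f\<close> into the preimage of a small neighborhood, which is a
  \<open>CC\<close>-Maslyuchenko space. There are countably many basic boxes, so the countably many exceptional sets
  inside them, together with the one of \<open>\<phi> \<circ> f\<close>, form a meager set.\<close>

lemma CC_Maslyuchenko_fibered_preimage:
  assumes P: "CC_Maslyuchenko P" and \<phi>: "continuous_map Z P \<phi>"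
    and loc: "\<And>y. y \<in> topspace P \<Longrightarrow>
      \<exists>N. nbhd_in P {y} N \<and> CC_Maslyuchenko (subtopology Z {z \<in> topspace Z. \<phi> z \<in> N})"
  shows "CC_Maslyuchenko Z"
proof (rule CC_MaslyuchenkoI)
  fix X Y :: "(nat \<Rightarrow> real) topology" and f
  assume X: "second_countable X" "metrizable_space X" and Y: "second_countable Y" "metrizable_space Y"
    and f: "separately_continuous X Y Z f"
  obtain \<A> where \<A>: "countable \<A>" "\<And>U. U \<in> \<A> \<Longrightarrow> openin X U"
    "\<And>U x. openin X U \<Longrightarrow> x \<in> U \<Longrightarrow> \<exists>V\<in>\<A>. x \<in> V \<and> V \<subseteq> U"
    using X by (auto simp: second_countable_def)
  obtain \<B> where \<B>: "countable \<B>" "\<And>V. V \<in> \<B> \<Longrightarrow> openin Y V"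
    "\<And>U y. openin Y U \<Longrightarrow> y \<in> U \<Longrightarrow> \<exists>V\<in>\<B>. y \<in> V \<and> V \<subseteq> U"
    using Y by (auto simp: second_countable_def)
  let ?D = "disc_points (prod_topology X Y) Z f"
  let ?D\<phi> = "disc_points (prod_topology X Y) P (\<phi> \<circ> f)"
  define \<G> where "\<G> = {(U, V) \<in> \<A> \<times> \<B>. \<exists>T. f ` (U \<times> V) \<subseteq> T \<and> CC_Maslyuchenko (subtopology Z T)}"
  let ?N = "fst ` ?D\<phi> \<union> (\<Union>G\<in>\<G>. fst ` (?D \<inter> fst G \<times> snd G))"
  have "countable \<G>"
    by (rule countable_subset[of _ "\<A> \<times> \<B>"]) (use \<A>(1) \<B>(1) in \<open>auto simp: \<G>_def\<close>)
  moreover have "meager_in X (fst ` (?D \<inter> fst G \<times> snd G))" if G0: "G \<in> \<G>" for G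
  proof -
    obtain T where G: "fst G \<in> \<A>" "snd G \<in> \<B>" "f ` (fst G \<times> snd G) \<subseteq> T"
      "CC_Maslyuchenko (subtopology Z T)"
      using G0 unfolding \<G>_def by (cases G) auto
    show ?thesis by (rule CC_piece_meager_disc_on_box[OF G(4) X Y f \<A>(2)[OF G(1)] \<B>(2)[OF G(2)] G(3)])
  qed
  moreover have "meager_in X (fst ` ?D\<phi>)"
    by (rule CC_meager_disc[OF P X Y separately_continuous_compose[OF f \<phi>]])
  ultimately have "meager_in X ?N" by (intro meager_in_Un meager_in_countable_UN)
  moreover have "fst ` ?D \<subseteq> ?N"
  proof
    fix x assume "x \<in> fst ` ?D"
    then obtain y where D: "(x, y) \<in> ?D" by force
    show "x \<in> ?N"
    proof (cases "(x, y) \<in> ?D\<phi>")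
      case True
      then show ?thesis by force
    next
      case False
      then have c: "topcontinuous_at (prod_topology X Y) P (\<phi> \<circ> f) (x, y)"
        using D by (auto simp: disc_points_def)
      then have "\<phi> (f (x, y)) \<in> topspace P" unfolding topcontinuous_at_def by auto
      then obtain N O' where N: "CC_Maslyuchenko (subtopology Z {z \<in> topspace Z. \<phi> z \<in> N})"
        "openin P O'" "\<phi> (f (x, y)) \<in> O'" "O' \<subseteq> N"
        using loc[of "\<phi> (f (x, y))"] by (auto simp: nbhd_in_def)
      obtain W where W: "openin (prod_topology X Y) W" "(x, y) \<in> W" "\<forall>p\<in>W. \<phi> (f p) \<in> O'"
        using topcontinuous_atD[OF c N(2)] N(3) by auto
      obtain U V where UV: "openin X U" "openin Y V" "x \<in> U" "y \<in> V" "U \<times> V \<subseteq> W"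
        by (rule openin_prod_topology_boxE[OF W(1,2)])
      obtain A where A: "A \<in> \<A>" "x \<in> A" "A \<subseteq> U" using \<A>(3)[OF UV(1,3)] by blast
      obtain B where B: "B \<in> \<B>" "y \<in> B" "B \<subseteq> V" using \<B>(3)[OF UV(2,4)] by blast
      have AB: "A \<times> B \<subseteq> W" using A(3) B(3) UV(5) by blast
      have "f ` (A \<times> B) \<subseteq> {z \<in> topspace Z. \<phi> z \<in> N}"
      proof
        fix z assume "z \<in> f ` (A \<times> B)"
        then obtain p where p: "p \<in> W" "z = f p" using AB by blast
        then have "p \<in> topspace (prod_topology X Y)" using W(1) openin_subset by blast
        then have "f p \<in> topspace Z" using separately_continuousD(3)[OF f] by blast
        then show "z \<in> {z \<in> topspace Z. \<phi> z \<in> N}" using W(3) N(4) p by auto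
      qed
      then have "(A, B) \<in> \<G>" using N(1) A(1) B(1) unfolding \<G>_def by blast
      moreover have "x \<in> fst ` (?D \<inter> A \<times> B)" using D A(2) B(2) by force
      ultimately show ?thesis by (intro UnI2 UN_I[of "(A, B)"]) auto
    qed
  qed
  ultimately show "meager_in X (fst ` ?D)" by (rule meager_in_subset)
qed

section \<open>Strong sums\<close>

text \<open>Every vertical section is locally contained in some \<open>A n\<close>: otherwise there would be \<open>v\<^sub>n \<rightarrow> y\<close> with
  \<open>f (x, v\<^sub>n) \<notin> A n\<close>, a convergent sequence that lies in no \<open>A n\<close>. So the closed pieces \<open>A n\<close> carry all discontinuity points.\<close>

lemma CC_Maslyuchenko_strong_sigma_sum:
  fixes A :: "nat \<Rightarrow> 'a set"
  assumes cover: "topspace Z = (\<Union>n. A n)"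
    and A: "\<And>n. closedin Z (A n)" "\<And>n. CC_Maslyuchenko (subtopology Z (A n))"
    and seq: "\<And>(s :: nat \<Rightarrow> 'a) l. range s \<subseteq> topspace Z \<Longrightarrow> limitin Z s l sequentially \<Longrightarrow>
      \<exists>n. range s \<subseteq> A n"
  shows "CC_Maslyuchenko Z"
proof (rule CC_MaslyuchenkoI)
  fix X Y :: "(nat \<Rightarrow> real) topology" and f
  assume X: "second_countable X" "metrizable_space X" and Y: "second_countable Y" "metrizable_space Y"
    and f: "separately_continuous X Y Z f"
  let ?D = "disc_points (prod_topology X Y) Z f"
  define E where "E n = {(x, y) \<in> ?D. \<exists>V. openin Y V \<and> y \<in> V \<and> f ` ({x} \<times> V) \<subseteq> A n}" for n
  have "meager_in X (fst ` E n)" for n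
    by (rule meager_projection_of_CC_piece[OF X Y f A(1,2)[of n]]) (auto simp: E_def)
  then have "meager_in X (\<Union>n. fst ` E n)" by (intro meager_in_countable_UN) auto
  moreover have "?D \<subseteq> (\<Union>n. E n)"
  proof
    fix p assume p: "p \<in> ?D"
    obtain x y where xy: "p = (x, y)" by (cases p)
    have x: "x \<in> topspace X" and y: "y \<in> topspace Y" using p by (auto simp: xy disc_points_def)
    have c: "continuous_map Y Z (\<lambda>y. f (x, y))" by (rule separately_continuousD(1)[OF f x])
    show "p \<in> (\<Union>n. E n)"
    proof (rule ccontr)
      assume "\<not> ?thesis"
      then have no: "\<not> f ` ({x} \<times> V) \<subseteq> A n" if "openin Y V" "y \<in> V" for V n
        using that p by (auto simp: E_def xy)
      obtain W :: "nat \<Rightarrow> (nat \<Rightarrow> real) set" where W: "\<And>n. openin Y (W n)" "\<And>n. y \<in> W n"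
        "\<And>s. (\<And>n. s n \<in> W n) \<Longrightarrow> limitin Y s y sequentially"
        using metrizable_imp_converging_choices[OF Y(2) y] by blast
      have "\<forall>n. \<exists>v. v \<in> W n \<and> f (x, v) \<notin> A n" using no[OF W(1,2)] by auto
      then obtain s where s: "\<And>n. s n \<in> W n" "\<And>n. f (x, s n) \<notin> A n" by metis
      have "limitin Z ((\<lambda>y. f (x, y)) \<circ> s) (f (x, y)) sequentially"
        by (rule continuous_map_limit[OF c W(3)[OF s(1)]])
      moreover have "range ((\<lambda>y. f (x, y)) \<circ> s) \<subseteq> topspace Z"
        using c s(1) W(1) openin_subset by (fastforce simp: continuous_map_def)
      ultimately obtain n where "range ((\<lambda>y. f (x, y)) \<circ> s) \<subseteq> A n" using seq by blast
      then show False using s(2)[of n] by auto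
    qed
  qed
  then have "fst ` ?D \<subseteq> (\<Union>n. fst ` E n)" by (rule image_subset_UN)
  ultimately show "meager_in X (fst ` ?D)" by (rule meager_in_subset)
qed

section \<open>Retral unions\<close>

text \<open>If \<open>f p\<close> belongs to all the pieces \<open>A i\<close>, then each retraction fixes \<open>f p\<close>, and each nearby value \<open>f q\<close> is
  fixed by the retraction onto the piece that contains it. So \<open>f q = r i (f q)\<close> stays close to \<open>f p\<close> for
  a suitable \<open>i\<close>, and finitely many \<open>i\<close> have to be considered.\<close>

lemma topcontinuous_at_glue_retractions:
  assumes p: "p \<in> topspace X" "f \<in> topspace X \<rightarrow> topspace Z" and W: "openin X W" "p \<in> W"
    and I: "finite I" "I \<noteq> {}"
    and cover: "\<And>q. q \<in> W \<Longrightarrow> \<exists>i\<in>I. f q \<in> A i"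
    and r: "\<And>i. i \<in> I \<Longrightarrow> topcontinuous_at (subtopology X W) (subtopology Z (A i)) (r i \<circ> f) p"
      "\<And>i z. i \<in> I \<Longrightarrow> z \<in> A i \<Longrightarrow> r i z = z"
    and fp: "\<And>i. i \<in> I \<Longrightarrow> f p \<in> A i"
  shows "topcontinuous_at X Z f p"
  unfolding topcontinuous_at_def
proof (intro conjI allI impI)
  fix O' assume O': "openin Z O' \<and> f p \<in> O'"
  have "\<forall>i\<in>I. \<exists>U. openin (subtopology X W) U \<and> p \<in> U \<and> (\<forall>q\<in>U. (r i \<circ> f) q \<in> O' \<inter> A i)"
  proof
    fix i assume i: "i \<in> I"
    have "openin (subtopology Z (A i)) (O' \<inter> A i)" using O' by (simp add: openin_subtopology_Int)
    moreover have "(r i \<circ> f) p \<in> O' \<inter> A i" using O' fp[OF i] r(2)[OF i] by simp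
    ultimately show "\<exists>U. openin (subtopology X W) U \<and> p \<in> U \<and> (\<forall>q\<in>U. (r i \<circ> f) q \<in> O' \<inter> A i)"
      using r(1)[OF i] unfolding topcontinuous_at_def by blast
  qed
  then obtain U where U: "\<And>i. i \<in> I \<Longrightarrow> openin (subtopology X W) (U i)" "\<And>i. i \<in> I \<Longrightarrow> p \<in> U i"
    "\<And>i q. i \<in> I \<Longrightarrow> q \<in> U i \<Longrightarrow> r i (f q) \<in> O'"
    by (metis IntD1 comp_apply)
  have "openin X (U i)" if "i \<in> I" for i using U(1)[OF that] W(1) openin_trans_full by blast
  then have "openin X (\<Inter>i\<in>I. U i)" using I by (intro openin_INT2) auto
  moreover have "f q \<in> O'" if q: "q \<in> (\<Inter>i\<in>I. U i)" for q
  proof -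
    have "q \<in> W" using q U(1) I(2) openin_subset by fastforce
    then obtain i where i: "i \<in> I" "f q \<in> A i" using cover by blast
    then show ?thesis using U(3)[OF i(1), of q] q r(2)[OF i] by auto
  qed
  ultimately show "\<exists>U. openin X U \<and> p \<in> U \<and> (\<forall>q\<in>U. f q \<in> O')" using U(2) by blast
qed (use p in auto)

text \<open>Sort the points \<open>p\<close> by the set \<open>I\<close> of those indices \<open>i\<close> for which \<open>f p \<in> A i\<close>. The pieces outside \<open>I\<close> are
  closed and miss \<open>f p\<close>, so near \<open>f p\<close> the space consists of \<open>\<Union>i\<in>I. A i\<close> only, and it lies inside all closed
  neighborhoods \<open>N i\<close>, \<open>i \<in> I\<close>, on which the retractions are defined. Hence the closed set
  \<open>T I = (\<Inter>i\<in>I. N i) \<inter> (\<Union>i\<in>I. A i)\<close> contains the values of \<open>f\<close> on a vertical neighborhood of \<open>p\<close>. On a box that is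
  mapped into \<open>T I\<close>, a discontinuity of \<open>f\<close> at \<open>p\<close> forces a discontinuity of some \<open>r i \<circ> f\<close>.\<close>

lemma CC_Maslyuchenko_retral_union:
  assumes fin: "finite J" and cover: "topspace Z = (\<Union>i\<in>J. A i)"
    and A: "\<And>i. i \<in> J \<Longrightarrow> neighborhood_retract_in Z (A i)"
      "\<And>i. i \<in> J \<Longrightarrow> CC_Maslyuchenko (subtopology Z (A i))"
  shows "CC_Maslyuchenko Z"
proof (rule CC_MaslyuchenkoI)
  fix X Y :: "(nat \<Rightarrow> real) topology" and f
  assume X: "second_countable X" "metrizable_space X" and Y: "second_countable Y" "metrizable_space Y"
    and f: "separately_continuous X Y Z f"
  let ?XY = "prod_topology X Y"
  let ?D = "disc_points ?XY Z f"
  have clA: "closedin Z (A i)" if "i \<in> J" for i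
    using A(1)[OF that] unfolding neighborhood_retract_in_def by (rule conjunct1)
  have "\<forall>i\<in>J. \<exists>N G r. closedin Z N \<and> openin Z G \<and> A i \<subseteq> G \<and> G \<subseteq> N \<and>
      continuous_map (subtopology Z N) (subtopology Z (A i)) r \<and> (\<forall>z\<in>A i. r z = z)"
  proof
    fix i assume i: "i \<in> J"
    obtain N G where N: "closedin Z N" "openin Z G" "A i \<subseteq> G" "G \<subseteq> N"
      "A i retract_of_space (subtopology Z N)"
      using A(1)[OF i] unfolding neighborhood_retract_in_def nbhd_in_def by (elim exE conjE)
    have "subtopology (subtopology Z N) (A i) = subtopology Z (A i)"
      using N(3,4) by (simp add: subtopology_subtopology Int_absorb1)
    then obtain r where "continuous_map (subtopology Z N) (subtopology Z (A i)) r" "\<forall>z\<in>A i. r z = z"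
      using N(5) unfolding retract_of_space_def by auto
    with N show "\<exists>N G r. closedin Z N \<and> openin Z G \<and> A i \<subseteq> G \<and> G \<subseteq> N \<and>
      continuous_map (subtopology Z N) (subtopology Z (A i)) r \<and> (\<forall>z\<in>A i. r z = z)"
      by blast
  qed
  from bchoice[OF this] obtain N where "\<forall>i\<in>J. \<exists>G r. closedin Z (N i) \<and> openin Z G \<and>
      A i \<subseteq> G \<and> G \<subseteq> N i \<and>
      continuous_map (subtopology Z (N i)) (subtopology Z (A i)) r \<and> (\<forall>z\<in>A i. r z = z)" ..
  from bchoice[OF this] obtain G where "\<forall>i\<in>J. \<exists>r. closedin Z (N i) \<and> openin Z (G i) \<and>
      A i \<subseteq> G i \<and> G i \<subseteq> N i \<and>
      continuous_map (subtopology Z (N i)) (subtopology Z (A i)) r \<and> (\<forall>z\<in>A i. r z = z)" ..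
  from bchoice[OF this] obtain r where NGr: "\<forall>i\<in>J. closedin Z (N i) \<and> openin Z (G i) \<and>
      A i \<subseteq> G i \<and> G i \<subseteq> N i \<and>
      continuous_map (subtopology Z (N i)) (subtopology Z (A i)) (r i) \<and> (\<forall>z\<in>A i. r i z = z)" ..
  have N: "\<And>i. i \<in> J \<Longrightarrow> closedin Z (N i)" "\<And>i. i \<in> J \<Longrightarrow> openin Z (G i)"
    "\<And>i. i \<in> J \<Longrightarrow> A i \<subseteq> G i" "\<And>i. i \<in> J \<Longrightarrow> G i \<subseteq> N i"
    "\<And>i. i \<in> J \<Longrightarrow> continuous_map (subtopology Z (N i)) (subtopology Z (A i)) (r i)"
    "\<And>i z. i \<in> J \<Longrightarrow> z \<in> A i \<Longrightarrow> r i z = z"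
    using NGr by simp_all
  define E where "E I = {p \<in> ?D. {i \<in> J. f p \<in> A i} = I}" for I
  define T where "T I = (\<Inter>i\<in>I. N i) \<inter> (\<Union>i\<in>I. A i)" for I
  have mE: "meager_in X (fst ` E I)" if I: "I \<subseteq> J" "I \<noteq> {}" for I
  proof (rule meager_projection_of_closed_piece[OF Y(1) f, of "T I"])
    have finI: "finite I" using I(1) fin finite_subset by blast
    have "closedin Z (\<Inter>i\<in>I. N i)" using N(1) I by (intro closedin_INT) auto
    moreover have "closedin Z (\<Union>i\<in>I. A i)" using clA I finI by (intro closedin_Union) auto
    ultimately show "closedin Z (T I)" unfolding T_def by (rule closedin_Int)
    \<comment> \<open>The open set near \<open>f p\<close> on which only the pieces from \<open>I\<close> are present and their retractions are defined.\<close>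
    have W: "openin Z ((\<Inter>i\<in>I. G i) - (\<Union>i\<in>J - I. A i))"
      using N(2) clA I finI fin by (intro openin_diff openin_INT2 closedin_Union) auto
    have WT: "(\<Inter>i\<in>I. G i) - (\<Union>i\<in>J - I. A i) \<subseteq> T I"
    proof
      fix z assume z: "z \<in> (\<Inter>i\<in>I. G i) - (\<Union>i\<in>J - I. A i)"
      then have "z \<in> topspace Z" using W openin_subset by blast
      then obtain j where "j \<in> J" "z \<in> A j" using cover by blast
      then show "z \<in> T I" using z N(4) I(1) by (auto simp: T_def)
    qed
    fix x y assume xy: "(x, y) \<in> E I"
    then have x: "x \<in> topspace X" and y: "y \<in> topspace Y" by (auto simp: E_def disc_points_def)
    have "f (x, y) \<in> (\<Inter>i\<in>I. G i) - (\<Union>i\<in>J - I. A i)" using xy N(3) by (auto simp: E_def)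
    then show "x \<in> topspace X \<and> (\<exists>V. openin Y V \<and> y \<in> V \<and> f ` ({x} \<times> V) \<subseteq> T I)"
      using openin_continuous_map_preimage[OF separately_continuousD(1)[OF f x] W] x y WT
      by (intro conjI exI[of _ "{v \<in> topspace Y. f (x, v) \<in> (\<Inter>i\<in>I. G i) - (\<Union>i\<in>J - I. A i)}"]) auto
  next
    fix U V assume UV: "openin X U" "openin Y V" "f ` (U \<times> V) \<subseteq> T I"
    have finI: "finite I" using I(1) fin finite_subset by blast
    have o: "openin ?XY (U \<times> V)" using UV by (simp add: openin_prod_Times_iff)
    let ?Dr = "\<lambda>i. disc_points (subtopology ?XY (U \<times> V)) (subtopology Z (A i)) (r i \<circ> f)"
    have "meager_in X (fst ` ?Dr i)" if i: "i \<in> I" for i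
    proof -
      have iJ: "i \<in> J" using i I by blast
      have "continuous_map (subtopology Z (T I)) (subtopology Z (A i)) (r i)"
        using continuous_map_from_subtopology_mono[OF N(5)[OF iJ], of "T I"] i by (auto simp: T_def)
      then show ?thesis by (rule CC_meager_disc_on_box[OF A(2)[OF iJ] X Y f _ UV])
    qed
    then have "meager_in X (\<Union>i\<in>I. fst ` ?Dr i)"
      using finI by (intro meager_in_countable_UN countable_finite)
    moreover have "E I \<inter> U \<times> V \<subseteq> (\<Union>i\<in>I. ?Dr i)"
    proof
      fix p assume p: "p \<in> E I \<inter> U \<times> V"
      then have pD: "p \<in> ?D" "p \<in> topspace ?XY" by (auto simp: E_def disc_points_def)
      show "p \<in> (\<Union>i\<in>I. ?Dr i)"
      proof (rule ccontr)
        assume no: "\<not> ?thesis"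
        have "topcontinuous_at ?XY Z f p"
        proof (rule topcontinuous_at_glue_retractions[OF pD(2) separately_continuousD(3)[OF f] o _ finI I(2)])
          show "topcontinuous_at (subtopology ?XY (U \<times> V)) (subtopology Z (A i)) (r i \<circ> f) p"
            if "i \<in> I" for i
            using no that p pD(2) by (auto simp: disc_points_def)
          show "r i z = z" if "i \<in> I" "z \<in> A i" for i z using N(6) that I(1) by blast
          show "\<exists>i\<in>I. f q \<in> A i" if "q \<in> U \<times> V" for q
            using UV(3) that unfolding T_def by blast
        qed (use p in \<open>auto simp: E_def\<close>)
        then show False using pD(1) by (simp add: disc_points_def)
      qed
    qed
    then have "fst ` (E I \<inter> U \<times> V) \<subseteq> (\<Union>i\<in>I. fst ` ?Dr i)" by (rule image_subset_UN)
    ultimately show "meager_in X (fst ` (E I \<inter> U \<times> V))" by (rule meager_in_subset)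
  qed
  have "meager_in X (\<Union>I\<in>Pow J - {{}}. fst ` E I)"
    using fin mE by (intro meager_in_countable_UN countable_finite) auto
  moreover have "?D \<subseteq> (\<Union>I\<in>Pow J - {{}}. E I)"
  proof
    fix p assume p: "p \<in> ?D"
    then have "p \<in> topspace ?XY" by (simp add: disc_points_def)
    then have "f p \<in> topspace Z" using separately_continuousD(3)[OF f] by blast
    then have "{i \<in> J. f p \<in> A i} \<noteq> {}" using cover by auto
    moreover have "p \<in> E {i \<in> J. f p \<in> A i}" using p by (simp add: E_def)
    ultimately show "p \<in> (\<Union>I\<in>Pow J - {{}}. E I)"
      by (intro UN_I[of "{i \<in> J. f p \<in> A i}"]) auto
  qed
  then have "fst ` ?D \<subseteq> (\<Union>I\<in>Pow J - {{}}. fst ` E I)" by (rule image_subset_UN)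
  ultimately show "meager_in X (fst ` ?D)" by (rule meager_in_subset)
qed

section \<open>Michael modifications\<close>

text \<open>The basic open sets coming from \<open>X\<close>: the preimages under \<open>Michael_projection\<close>.\<close>

definition Michael_preimage :: "'a topology \<Rightarrow> 'a topology \<Rightarrow> ('a \<Rightarrow> 'a) \<Rightarrow> 'a set \<Rightarrow> 'a set" where
  "Michael_preimage L X g U = {x \<in> topspace L. g x \<in> U} \<union> (U - g ` topspace L)"

lemma openin_Michael_modification_domain:
  "openin L V \<Longrightarrow> openin (Michael_modification L X g) V"
  unfolding Michael_modification_def Michael_base_def by (rule topology_generated_by_Basis) blast

lemma openin_Michael_modification_preimage:
  "openin X U \<Longrightarrow> openin (Michael_modification L X g) (Michael_preimage L X g U)"
  unfolding Michael_modification_def Michael_base_def Michael_preimage_def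
  by (rule topology_generated_by_Basis) blast

text \<open>The two families of generators are a base of neighborhoods: around points of \<open>L\<close> the topology is that of \<open>L\<close>,
  and around the other points it is the one induced by the projection to \<open>X\<close>.\<close>

lemma openin_Michael_modificationD:
  assumes g: "continuous_map L X g" and disj: "topspace L \<inter> (topspace X - g ` topspace L) = {}"
    and W: "openin (Michael_modification L X g) W"
  shows "openin L (W \<inter> topspace L)"
    and "\<And>x. x \<in> W \<Longrightarrow> x \<notin> topspace L \<Longrightarrow>
      \<exists>U. openin X U \<and> x \<in> U \<and> Michael_preimage L X g U \<subseteq> W"
proof -
  let ?P = "\<lambda>W. openin L (W \<inter> topspace L) \<and> (\<forall>x\<in>W. x \<notin> topspace L \<longrightarrow>
      (\<exists>U. openin X U \<and> x \<in> U \<and> Michael_preimage L X g U \<subseteq> W))"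
  have "generate_topology_on (Michael_base L X g) W"
    using W unfolding Michael_modification_def by (rule openin_topology_generated_by)
  then have "?P W"
  proof (induction rule: generate_topology_on.induct)
    case Empty
    then show ?case by simp
  next
    case (Int a b)
    have "a \<inter> b \<inter> topspace L = (a \<inter> topspace L) \<inter> (b \<inter> topspace L)" by auto
    then have 1: "openin L (a \<inter> b \<inter> topspace L)" using Int.IH by (simp add: openin_Int)
    have "\<exists>U. openin X U \<and> x \<in> U \<and> Michael_preimage L X g U \<subseteq> a \<inter> b"
      if x: "x \<in> a \<inter> b" "x \<notin> topspace L" for x
    proof -
      obtain U where U: "openin X U" "x \<in> U" "Michael_preimage L X g U \<subseteq> a" using Int.IH(1) x by auto
      obtain U' where U': "openin X U'" "x \<in> U'" "Michael_preimage L X g U' \<subseteq> b" using Int.IH(2) x by auto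
      have "Michael_preimage L X g (U \<inter> U') \<subseteq> a \<inter> b"
        using U(3) U'(3) by (auto simp: Michael_preimage_def)
      then show ?thesis using U(1,2) U'(1,2) by (intro exI[of _ "U \<inter> U'"]) auto
    qed
    with 1 show ?case by blast
  next
    case (UN K)
    have "\<Union>K \<inter> topspace L = (\<Union>k\<in>K. k \<inter> topspace L)" by auto
    moreover have "openin L (\<Union>k\<in>K. k \<inter> topspace L)"
      using UN.IH by (intro openin_Union) auto
    ultimately have 1: "openin L (\<Union>K \<inter> topspace L)" by simp
    have "\<exists>U. openin X U \<and> x \<in> U \<and> Michael_preimage L X g U \<subseteq> \<Union>K"
      if x: "x \<in> \<Union>K" "x \<notin> topspace L" for x
    proof -
      obtain k where k: "k \<in> K" "x \<in> k" using x by auto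
      then obtain U where "openin X U" "x \<in> U" "Michael_preimage L X g U \<subseteq> k" using UN.IH[OF k(1)] x(2) by auto
      then show ?thesis using k(1) by (intro exI[of _ U]) auto
    qed
    with 1 show ?case by blast
  next
    case (Basis s)
    then consider "openin L s" | U where "openin X U" "s = Michael_preimage L X g U"
      unfolding Michael_base_def Michael_preimage_def by blast
    then show ?case
    proof cases
      case 1
      then have "s \<subseteq> topspace L" by (rule openin_subset)
      with 1 show ?thesis by (auto simp: Int_absorb2)
    next
      case (2 U)
      have "U \<subseteq> topspace X" using 2(1) by (rule openin_subset)
      then have "s \<inter> topspace L = {x \<in> topspace L. g x \<in> U}"
        using disj 2(2) by (auto simp: Michael_preimage_def)
      then have "openin L (s \<inter> topspace L)"
        using openin_continuous_map_preimage[OF g 2(1)] by simp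
      moreover have "x \<in> U" if "x \<in> s" "x \<notin> topspace L" for x
        using that 2(2) by (simp add: Michael_preimage_def)
      ultimately show ?thesis using 2 by blast
    qed
  qed
  then show "openin L (W \<inter> topspace L)"
    "\<And>x. x \<in> W \<Longrightarrow> x \<notin> topspace L \<Longrightarrow> \<exists>U. openin X U \<and> x \<in> U \<and> Michael_preimage L X g U \<subseteq> W"
    by auto
qed

text \<open>The map \<open>X\<^sub>g \<rightarrow> X\<close> that extends \<open>g\<close> by the identity.\<close>

definition Michael_projection :: "'a topology \<Rightarrow> ('a \<Rightarrow> 'a) \<Rightarrow> 'a \<Rightarrow> 'a" where
  "Michael_projection L g z = (if z \<in> topspace L then g z else z)"

lemma Michael_preimage_projection:
  assumes "continuous_map L X g" "U \<subseteq> topspace X"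
    and "topspace L \<inter> (topspace X - g ` topspace L) = {}"
  shows "Michael_preimage L X g U
    = {z \<in> topspace (Michael_modification L X g). Michael_projection L g z \<in> U}"
  using assms(2,3) unfolding topspace_Michael_modification[OF assms(1)] Michael_preimage_def
    Michael_projection_def by auto

lemma continuous_map_Michael_projection:
  assumes g: "continuous_map L X g" and disj: "topspace L \<inter> (topspace X - g ` topspace L) = {}"
  shows "continuous_map (Michael_modification L X g) X (Michael_projection L g)"
  unfolding continuous_map_def
proof (intro conjI allI impI)
  show "Michael_projection L g \<in> topspace (Michael_modification L X g) \<rightarrow> topspace X"
    using g unfolding topspace_Michael_modification[OF g] Michael_projection_def
    by (auto simp: continuous_map_def)
  show "openin (Michael_modification L X g)
      {z \<in> topspace (Michael_modification L X g). Michael_projection L g z \<in> U}" if "openin X U" for U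
    using openin_Michael_modification_preimage[OF that, of L g]
    by (simp add: Michael_preimage_projection[OF g openin_subset[OF that] disj])
qed

text \<open>Two points with different projections are separated in \<open>X\<close>; two points with the same projection both
  belong to \<open>L\<close>, which is open.\<close>

lemma Hausdorff_Michael_modification:
  assumes g: "continuous_map L X g" and disj: "topspace L \<inter> (topspace X - g ` topspace L) = {}"
    and H: "Hausdorff_space L" "Hausdorff_space X"
  shows "Hausdorff_space (Michael_modification L X g)"
  unfolding Hausdorff_space_def
proof (intro allI impI)
  let ?M = "Michael_modification L X g" and ?\<pi> = "Michael_projection L g"
  have c: "continuous_map ?M X ?\<pi>" by (rule continuous_map_Michael_projection[OF g disj])
  fix z w assume zw: "z \<in> topspace ?M \<and> w \<in> topspace ?M \<and> z \<noteq> w"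
  show "\<exists>U V. openin ?M U \<and> openin ?M V \<and> z \<in> U \<and> w \<in> V \<and> disjnt U V"
  proof (cases "?\<pi> z = ?\<pi> w")
    case True
    then have "z \<in> topspace L" "w \<in> topspace L"
      using zw unfolding topspace_Michael_modification[OF g] Michael_projection_def
      by (auto split: if_splits)
    then show ?thesis
      using H(1) zw unfolding Hausdorff_space_def by (meson openin_Michael_modification_domain)
  next
    case False
    have "?\<pi> z \<in> topspace X" "?\<pi> w \<in> topspace X" using c zw by (auto simp: continuous_map_def)
    then obtain U V where UV: "openin X U" "openin X V" "?\<pi> z \<in> U" "?\<pi> w \<in> V" "disjnt U V"
      using H(2) False unfolding Hausdorff_space_def by metis
    let ?p = "\<lambda>U. {z \<in> topspace ?M. ?\<pi> z \<in> U}"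
    have "openin ?M (?p U)" "openin ?M (?p V)"
      using UV(1,2) c by (auto intro: openin_continuous_map_preimage)
    moreover have "disjnt (?p U) (?p V)" using UV(5) by (auto simp: disjnt_def)
    ultimately show ?thesis using zw UV(3,4) by (intro exI[of _ "?p U"] exI[of _ "?p V"]) auto
  qed
qed

lemma subtopology_Michael_modification:
  assumes g: "continuous_map L X g" and disj: "topspace L \<inter> (topspace X - g ` topspace L) = {}"
  shows "subtopology (Michael_modification L X g) (topspace L) = L"
  unfolding topology_eq openin_subtopology
proof (intro allI iffI)
  fix S assume "\<exists>T. openin (Michael_modification L X g) T \<and> S = T \<inter> topspace L"
  then show "openin L S" using openin_Michael_modificationD(1)[OF g disj] by blast
next
  fix S assume S: "openin L S"
  then have "S = S \<inter> topspace L" using openin_subset by blast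
  then show "\<exists>T. openin (Michael_modification L X g) T \<and> S = T \<inter> topspace L"
    using openin_Michael_modification_domain[OF S] by blast
qed

text \<open>The image of a separable product is separable: take the image of \<open>C \<times> D\<close> for dense sets \<open>C\<close> and \<open>D\<close>, and move first
  the second and then the first coordinate.\<close>

lemma separately_continuous_image_dense:
  assumes "separable_space X" "separable_space Y" and f: "separately_continuous X Y Z f"
  obtains Q where "countable Q" "Q \<subseteq> topspace Z"
    "\<And>W p. openin Z W \<Longrightarrow> p \<in> topspace (prod_topology X Y) \<Longrightarrow> f p \<in> W \<Longrightarrow> W \<inter> Q \<noteq> {}"
proof -
  obtain C D where C: "countable C" "C \<subseteq> topspace X" "X closure_of C = topspace X"
    and D: "countable D" "D \<subseteq> topspace Y" "Y closure_of D = topspace Y"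
    using assms(1,2) unfolding separable_space_def by blast
  have "W \<inter> f ` (C \<times> D) \<noteq> {}"
    if W: "openin Z W" "p \<in> topspace (prod_topology X Y)" "f p \<in> W" for W p
  proof -
    obtain x y where xy: "p = (x, y)" "x \<in> topspace X" "y \<in> topspace Y" using W(2) by auto
    have "openin Y {y \<in> topspace Y. f (x, y) \<in> W}"
      by (rule openin_continuous_map_preimage[OF separately_continuousD(1)[OF f xy(2)] W(1)])
    moreover have "y \<in> {y \<in> topspace Y. f (x, y) \<in> W}" using W(3) xy by simp
    ultimately have "D \<inter> {y \<in> topspace Y. f (x, y) \<in> W} \<noteq> {}"
      using D(3) unfolding dense_intersects_open by blast
    then obtain d where d: "d \<in> D" "d \<in> topspace Y" "f (x, d) \<in> W" by auto
    have "openin X {x \<in> topspace X. f (x, d) \<in> W}"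
      by (rule openin_continuous_map_preimage[OF separately_continuousD(2)[OF f d(2)] W(1)])
    moreover have "x \<in> {x \<in> topspace X. f (x, d) \<in> W}" using d(3) xy by simp
    ultimately have "C \<inter> {x \<in> topspace X. f (x, d) \<in> W} \<noteq> {}"
      using C(3) unfolding dense_intersects_open by blast
    then show ?thesis using d(1) by auto
  qed
  moreover have "f ` (C \<times> D) \<subseteq> topspace Z"
    using separately_continuousD(3)[OF f] C(2) D(2) by auto
  ultimately show ?thesis using that[of "f ` (C \<times> D)"] C(1) D(1) by blast
qed

text \<open>A point belongs to finitely many members of a locally finite family.\<close>

lemma locally_finite_countably_many_meet:
  assumes "locally_finite_in L \<V>" "countable Q" "Q \<subseteq> topspace L"
  shows "countable {V \<in> \<V>. V \<inter> Q \<noteq> {}}"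
proof -
  have "finite {V \<in> \<V>. q \<in> V}" if q: "q \<in> Q" for q
  proof -
    obtain N where "q \<in> N" "finite {V \<in> \<V>. V \<inter> N \<noteq> {}}"
      using assms(1,3) q unfolding locally_finite_in_def by blast
    then show ?thesis by (intro finite_subset[OF _ \<open>finite _\<close>]) auto
  qed
  then have "countable (\<Union>q\<in>Q. {V \<in> \<V>. q \<in> V})"
    using assms(2) by (intro countable_UN) (auto intro: countable_finite)
  then show ?thesis by (rule countable_subset[rotated]) auto
qed

lemma locally_compact_paracompact_cover:
  assumes "locally_compact_space L" "paracompact_space L"
  obtains \<V> where "locally_finite_in L \<V>" "\<Union>\<V> = topspace L"
    "\<And>V. V \<in> \<V> \<Longrightarrow> openin L V" "\<And>V. V \<in> \<V> \<Longrightarrow> compactin L (L closure_of V)"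
proof -
  have H: "Hausdorff_space L" using assms(2) by (simp add: paracompact_space_def)
  define \<U> where "\<U> = {U. openin L U \<and> compactin L (L closure_of U)}"
  have "topspace L \<subseteq> \<Union>\<U>"
    using assms(1) locally_compact_space_compact_closure_of[of L] H unfolding \<U>_def by blast
  moreover have "\<Union>\<U> \<subseteq> topspace L" unfolding \<U>_def using openin_subset by blast
  ultimately have "(\<forall>U\<in>\<U>. openin L U) \<and> \<Union>\<U> = topspace L" unfolding \<U>_def by blast
  from mp[OF spec[OF conjunct2[OF assms(2)[unfolded paracompact_space_def]], of \<U>] this]
  obtain \<V> where V: "\<forall>V\<in>\<V>. openin L V" "\<Union>\<V> = topspace L" "\<forall>V\<in>\<V>. \<exists>U\<in>\<U>. V \<subseteq> U"
    "locally_finite_in L \<V>"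
    by (elim exE conjE)
  have "compactin L (L closure_of V)" if V': "V \<in> \<V>" for V
  proof -
    obtain U where U: "U \<in> \<U>" "V \<subseteq> U" using V(3) V' by blast
    show ?thesis
      by (rule closed_compactin[of L "L closure_of U"])
        (use U(1) closure_of_mono[OF U(2)] in \<open>auto simp: \<U>_def\<close>)
  qed
  then show ?thesis using that[of \<V>] V by blast
qed

text \<open>At a point with \<open>f p \<notin> L\<close>, continuity of \<open>f\<close> is continuity of its projection to \<open>X\<close>. For the values in \<open>L\<close>, cover \<open>L\<close> by
  a locally finite family of open sets with compact closures. The image of \<open>f\<close> is separable, so it meets
  countably many of them only. Their closures in \<open>L\<close> are compact, hence closed in the Hausdorff space
  \<open>X\<^sub>g\<close>, and serve as the closed pieces.\<close>

lemma CC_Maslyuchenko_Michael_modification: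
  assumes H: "Hausdorff_space X" and X: "CC_Maslyuchenko X"
    and L: "locally_compact_space L" "paracompact_space L" "CC_Maslyuchenko L"
    and g: "continuous_map L X g" and disj: "topspace L \<inter> (topspace X - g ` topspace L) = {}"
  shows "CC_Maslyuchenko (Michael_modification L X g)"
proof (rule CC_MaslyuchenkoI)
  let ?M = "Michael_modification L X g" and ?\<pi> = "Michael_projection L g"
  fix A B :: "(nat \<Rightarrow> real) topology" and f
  assume A: "second_countable A" "metrizable_space A" and B: "second_countable B" "metrizable_space B"
    and f: "separately_continuous A B ?M f"
  let ?AB = "prod_topology A B"
  let ?D = "disc_points ?AB ?M f" and ?D\<pi> = "disc_points ?AB X (?\<pi> \<circ> f)"
  have HL: "Hausdorff_space L" using L(2) by (simp add: paracompact_space_def)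
  have fM: "f \<in> topspace ?AB \<rightarrow> topspace ?M" by (rule separately_continuousD(3)[OF f])
  obtain \<V> where V: "locally_finite_in L \<V>" "\<Union>\<V> = topspace L"
    "\<And>V. V \<in> \<V> \<Longrightarrow> openin L V" "\<And>V. V \<in> \<V> \<Longrightarrow> compactin L (L closure_of V)"
    using locally_compact_paracompact_cover[OF L(1,2)] by metis
  obtain Q where Q: "countable Q" "Q \<subseteq> topspace ?M"
    "\<And>W p. openin ?M W \<Longrightarrow> p \<in> topspace ?AB \<Longrightarrow> f p \<in> W \<Longrightarrow> W \<inter> Q \<noteq> {}"
    using separately_continuous_image_dense[OF second_countable_imp_separable_space[OF A(1)]
      second_countable_imp_separable_space[OF B(1)] f] by blast
  define \<W> where "\<W> = {V \<in> \<V>. V \<inter> (Q \<inter> topspace L) \<noteq> {}}"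
  have cW: "countable \<W>"
    unfolding \<W>_def using Q(1) by (intro locally_finite_countably_many_meet[OF V(1)]) auto
  define E where "E V = {p \<in> ?D. f p \<in> V}" for V
  have "meager_in A (fst ` E V)" if VW: "V \<in> \<W>" for V
  proof -
    have V': "V \<in> \<V>" using VW by (simp add: \<W>_def)
    let ?T = "L closure_of V"
    have TL: "?T \<subseteq> topspace L" by (rule closure_of_subset_topspace)
    have VT: "V \<subseteq> ?T" by (rule closure_of_subset[OF openin_subset[OF V(3)[OF V']]])
    have "compactin (subtopology ?M (topspace L)) ?T"
      using V(4)[OF V'] by (simp add: subtopology_Michael_modification[OF g disj])
    then have cl: "closedin ?M ?T"
      using compactin_imp_closedin[OF Hausdorff_Michael_modification[OF g disj HL H]]
      by (simp add: compactin_subtopology)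
    have "subtopology ?M ?T = subtopology L ?T"
      using TL subtopology_subtopology[of ?M "topspace L" ?T]
      by (simp add: subtopology_Michael_modification[OF g disj] Int_absorb1)
    then have CT: "CC_Maslyuchenko (subtopology ?M ?T)"
      using CC_Maslyuchenko_subtopology[OF L(3)] by simp
    show ?thesis
    proof (rule meager_projection_of_CC_piece[OF A B f cl CT])
      fix x y assume xy: "(x, y) \<in> E V"
      then have x: "x \<in> topspace A" and y: "y \<in> topspace B" by (auto simp: E_def disc_points_def)
      have "openin B {v \<in> topspace B. f (x, v) \<in> V}"
        by (rule openin_continuous_map_preimage[OF separately_continuousD(1)[OF f x]
          openin_Michael_modification_domain[OF V(3)[OF V']]])
      then show "\<exists>U. openin B U \<and> y \<in> U \<and> f ` ({x} \<times> U) \<subseteq> ?T"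
        using xy y VT by (intro exI[of _ "{v \<in> topspace B. f (x, v) \<in> V}"]) (auto simp: E_def)
    qed (auto simp: E_def)
  qed
  then have "meager_in A (\<Union>V\<in>\<W>. fst ` E V)" using cW by (intro meager_in_countable_UN)
  moreover have "meager_in A (fst ` ?D\<pi>)"
    by (rule CC_meager_disc[OF X A B
      separately_continuous_compose[OF f continuous_map_Michael_projection[OF g disj]]])
  ultimately have "meager_in A ((\<Union>V\<in>\<W>. fst ` E V) \<union> fst ` ?D\<pi>)" by (rule meager_in_Un)
  moreover have "?D \<subseteq> (\<Union>V\<in>\<W>. E V) \<union> ?D\<pi>"
  proof
    fix p assume p: "p \<in> ?D"
    then have pT: "p \<in> topspace ?AB" by (simp add: disc_points_def)
    show "p \<in> (\<Union>V\<in>\<W>. E V) \<union> ?D\<pi>"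
    proof (cases "f p \<in> topspace L")
      case True
      then obtain V where V': "V \<in> \<V>" "f p \<in> V" using V(2) by blast
      have "V \<inter> Q \<noteq> {}" by (rule Q(3)[OF openin_Michael_modification_domain[OF V(3)[OF V'(1)]] pT V'(2)])
      moreover have "V \<subseteq> topspace L" using V(3)[OF V'(1)] by (rule openin_subset)
      ultimately have "V \<in> \<W>" using V'(1) unfolding \<W>_def by blast
      then show ?thesis using p V'(2) by (auto simp: E_def)
    next
      case False
      have "p \<in> ?D\<pi>"
      proof (rule ccontr)
        assume "p \<notin> ?D\<pi>"
        then have c: "topcontinuous_at ?AB X (?\<pi> \<circ> f) p" using pT by (simp add: disc_points_def)
        have "topcontinuous_at ?AB ?M f p"
          unfolding topcontinuous_at_def
        proof (intro conjI allI impI)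
          fix W assume W: "openin ?M W \<and> f p \<in> W"
          then obtain U where U: "openin X U" "f p \<in> U" "Michael_preimage L X g U \<subseteq> W"
            using openin_Michael_modificationD(2)[OF g disj _ _ False] by blast
          have "(?\<pi> \<circ> f) p \<in> U" using False U(2) by (simp add: Michael_projection_def)
          then obtain N where N: "openin ?AB N" "p \<in> N" "\<forall>q\<in>N. (?\<pi> \<circ> f) q \<in> U"
            using topcontinuous_atD[OF c U(1)] by blast
          have "f q \<in> W" if q: "q \<in> N" for q
          proof -
            have "q \<in> topspace ?AB" using q N(1) openin_subset by blast
            then have "f q \<in> topspace ?M" using fM by blast
            then have "f q \<in> Michael_preimage L X g U"
              using N(3) q Michael_preimage_projection[OF g openin_subset[OF U(1)] disj] by simp
            then show ?thesis using U(3) by blast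
          qed
          then show "\<exists>N. openin ?AB N \<and> p \<in> N \<and> (\<forall>q\<in>N. f q \<in> W)" using N(1,2) by blast
        qed (use pT fM in auto)
        then show False using p by (simp add: disc_points_def)
      qed
      then show ?thesis ..
    qed
  qed
  then have "fst ` ?D \<subseteq> (\<Union>V\<in>\<W>. fst ` E V) \<union> fst ` ?D\<pi>" by blast
  ultimately show "meager_in A (fst ` ?D)" by (rule meager_in_subset)
qed

section \<open>Compact-covering maps onto \<open>\<aleph>\<^sub>0\<close>-spaces\<close>

lemma second_countable_euclidean:
  "second_countable (euclidean :: 'a :: second_countable_topology topology)"
proof -
  obtain \<B> :: "'a set set" where B: "countable \<B>" "\<And>C. C \<in> \<B> \<Longrightarrow> open C"
    "\<And>S. open S \<Longrightarrow> \<exists>U. U \<subseteq> \<B> \<and> S = \<Union>U"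
    by (rule univ_second_countable) blast
  have "\<exists>V\<in>\<B>. x \<in> V \<and> V \<subseteq> U" if U: "open U" "x \<in> U" for U x
  proof -
    obtain \<U> where "\<U> \<subseteq> \<B>" "U = \<Union>\<U>" using B(3)[OF U(1)] by auto
    then show ?thesis using U(2) by auto
  qed
  then show ?thesis unfolding second_countable_def
    using B(1,2) by (intro exI[of _ \<B>] conjI allI impI) auto
qed

lemma metrizable_space_nat_sequences: "metrizable_space (euclidean :: (nat \<Rightarrow> nat) topology)"
proof -
  have "(euclidean :: nat topology) = discrete_topology UNIV"
    by (simp add: topology_eq open_discrete)
  then have "metrizable_space (euclidean :: nat topology)"
    by (simp add: metrizable_space_discrete_topology)
  then have "metrizable_space (product_topology (\<lambda>_. euclidean :: nat topology) (UNIV :: nat set))"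
    by (simp add: metrizable_space_product_topology)
  then show ?thesis by (simp add: euclidean_product_topology)
qed

lemma open_finite_agreement:
  fixes s :: "nat \<Rightarrow> nat"
  assumes "finite J"
  shows "open {t. \<forall>i\<in>J. t i = s i}"
  using product_topology_basis'[of J "\<lambda>i. {s i}" "\<lambda>i. i"] assms by (simp add: open_discrete)

text \<open>In a regular space the closures of the members of a \<open>k\<close>-network form a \<open>k\<close>-network: shrink the neighborhood of the
  compact set first. The empty set is added so that the network can be enumerated by all natural numbers.\<close>

lemma aleph0_closed_k_network:
  assumes "aleph0_space X"
  obtains N :: "nat \<Rightarrow> 'a set" where "\<And>i. closedin X (N i)"
    "\<And>K W. compactin X K \<Longrightarrow> openin X W \<Longrightarrow> K \<subseteq> W \<Longrightarrow>
      \<exists>I. finite I \<and> K \<subseteq> (\<Union>i\<in>I. N i) \<and> (\<Union>i\<in>I. N i) \<subseteq> W"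
proof -
  obtain \<N> where N: "countable \<N>" "k_network X \<N>" and reg: "regular_space X"
    using assms by (auto simp: aleph0_space_def)
  define e where "e = from_nat_into (insert {} \<N>)"
  have e: "range e = insert {} \<N>"
    unfolding e_def using N(1) by (intro range_from_nat_into) auto
  have "\<exists>I. finite I \<and> K \<subseteq> (\<Union>i\<in>I. X closure_of e i) \<and> (\<Union>i\<in>I. X closure_of e i) \<subseteq> W"
    if K: "compactin X K" and W: "openin X W" "K \<subseteq> W" for K W
  proof -
    have "closedin X (topspace X - W)" using W(1) by blast
    moreover have "disjnt K (topspace X - W)" using W(2) by (auto simp: disjnt_def)
    ultimately obtain G H where G: "openin X G" "openin X H" "K \<subseteq> G" "topspace X - W \<subseteq> H" "disjnt G H"
      using regular_space_compact_closed_separation[OF reg K] by metis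
    have GW: "X closure_of G \<subseteq> W"
    proof -
      have "closedin X (topspace X - H)" using G(2) by blast
      moreover have "G \<subseteq> topspace X - H" using G(5) openin_subset[OF G(1)] by (auto simp: disjnt_def)
      ultimately have "X closure_of G \<subseteq> topspace X - H" by (rule closure_of_minimal[rotated])
      then show ?thesis using G(4) by blast
    qed
    have "nbhd_in X K G" using G(1,3) openin_subset[OF G(1)] by (auto simp: nbhd_in_def)
    with K have "compactin X K \<and> nbhd_in X K G" by (rule conjI)
    from mp[OF spec[OF spec[OF conjunct2[OF N(2)[unfolded k_network_def]]]] this]
    obtain \<F> where F: "finite \<F>" "\<F> \<subseteq> \<N>" "K \<subseteq> \<Union>\<F>" "\<Union>\<F> \<subseteq> G"
      by (elim exE conjE)
    have "\<F> \<subseteq> range e" using F(2) e by blast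
    then obtain I where I: "finite I" "\<F> = e ` I" using finite_subset_image[OF F(1)] by metis
    have eG: "e i \<subseteq> G" if "i \<in> I" for i using F(4) I(2) that by blast
    have eX: "e i \<subseteq> X closure_of e i" if "i \<in> I" for i
      using eG[OF that] openin_subset[OF G(1)] by (intro closure_of_subset) blast
    have "X closure_of e i \<subseteq> W" if "i \<in> I" for i using closure_of_mono[OF eG[OF that]] GW by (rule order_trans)
    then have "(\<Union>i\<in>I. X closure_of e i) \<subseteq> W" by (rule UN_least)
    moreover have "(\<Union>i\<in>I. e i) \<subseteq> (\<Union>i\<in>I. X closure_of e i)" by (intro UN_mono eX) auto
    then have "K \<subseteq> (\<Union>i\<in>I. X closure_of e i)" using F(3) I(2) by (metis order_trans)
    ultimately show ?thesis using I(1) by (intro exI[of _ I] conjI)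
  qed
  then show ?thesis using that[of "\<lambda>i. X closure_of e i"] by simp
qed

lemma compactin_Int_closed_family_empty:
  assumes K: "compactin X K" and N: "\<And>i. closedin X (N i)" and e: "K \<inter> (\<Inter>i. N i) = {}"
  obtains J where "finite J" "K \<inter> (\<Inter>i\<in>J. N i) = {}"
proof -
  have "\<exists>\<F>. finite \<F> \<and> \<F> \<subseteq> range N \<and> K \<inter> \<Inter>\<F> = {}"
  proof (rule ccontr)
    assume "\<not> ?thesis"
    then have "(\<forall>C\<in>range N. closedin X C) \<and> (\<forall>\<F>. finite \<F> \<and> \<F> \<subseteq> range N \<longrightarrow> K \<inter> \<Inter>\<F> \<noteq> {})"
      using N by auto
    moreover from K have "\<forall>\<U>. (\<forall>C\<in>\<U>. closedin X C) \<and> (\<forall>\<F>. finite \<F> \<and> \<F> \<subseteq> \<U> \<longrightarrow> K \<inter> \<Inter>\<F> \<noteq> {}) \<longrightarrow> K \<inter> \<Inter>\<U> \<noteq> {}"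
      unfolding compactin_fip by (rule conjunct2)
    from this[THEN spec, of "range N"] calculation have "K \<inter> \<Inter>(range N) \<noteq> {}" by (rule mp)
    then show False using e by simp
  qed
  then obtain \<F> where F: "finite \<F>" "\<F> \<subseteq> range N" "K \<inter> \<Inter>\<F> = {}" by (elim exE conjE)
  then obtain J where "finite J" "\<F> = N ` J" using finite_subset_image[OF F(1,2)] by metis
  then show ?thesis using F(3) that by simp
qed

lemma compact_finite_choices:
  fixes F :: "nat \<Rightarrow> nat set"
  assumes "\<And>i. finite (F i)"
  shows "compact {s. \<forall>i. s i \<in> F i}"
proof -
  have "compactin (product_topology (\<lambda>i. euclidean) UNIV) (PiE UNIV F)"
    unfolding compactin_PiE using assms by (auto intro: finite_imp_compact)
  moreover have "PiE UNIV F = {s. \<forall>i. s i \<in> F i}" by (auto simp: PiE_UNIV_domain)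
  ultimately show ?thesis by (simp add: euclidean_product_topology)
qed

text \<open>Michael's theorem that an \<open>\<aleph>\<^sub>0\<close>-space is a compact-covering image of a separable metrizable space. The
  points of \<open>M\<close> are the sequences \<open>s\<close> of indices for which the sets \<open>N (s i)\<close> contain a common point \<open>x\<close> and are
  arbitrarily small around it, and \<open>p s = x\<close>. Given a compact \<open>K\<close>, enumerate as \<open>F\<close> all finite sets of indices whose
  members cover \<open>K\<close>, and let \<open>C\<close> consist of the sequences that choose \<open>s i \<in> F i\<close> with a common point in \<open>K\<close>.
  By compactness of \<open>K\<close> this is a closed condition, so \<open>C\<close> is compact. Such a common point \<open>x\<close>
  automatically has the sets \<open>N (s i)\<close> as a small family around it: some \<open>F j\<close> splits into sets inside
  a given neighborhood of \<open>x\<close> and sets missing \<open>x\<close>.\<close>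

lemma aleph0_space_compact_covering_image:
  fixes X :: "'a topology"
  assumes X: "aleph0_space X"
  obtains M :: "(nat \<Rightarrow> nat) topology" and p where "second_countable M" "metrizable_space M"
    "continuous_map M X p" "\<And>K. compactin X K \<Longrightarrow> \<exists>C. compactin M C \<and> p ` C = K"
proof -
  obtain N :: "nat \<Rightarrow> 'a set" where clN: "\<And>i. closedin X (N i)"
    and net: "\<And>K W. compactin X K \<Longrightarrow> openin X W \<Longrightarrow> K \<subseteq> W \<Longrightarrow>
      \<exists>I. finite I \<and> K \<subseteq> (\<Union>i\<in>I. N i) \<and> (\<Union>i\<in>I. N i) \<subseteq> W"
    using aleph0_closed_k_network[OF X] by metis
  have H: "Hausdorff_space X" and reg: "regular_space X" using X by (auto simp: aleph0_space_def)
  define base_at where "base_at s x \<longleftrightarrow> x \<in> topspace X \<and> (\<forall>i. x \<in> N (s i)) \<and>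
      (\<forall>W. openin X W \<and> x \<in> W \<longrightarrow> (\<exists>i. N (s i) \<subseteq> W))" for s :: "nat \<Rightarrow> nat" and x
  have base_atD: "\<exists>i. N (s i) \<subseteq> W" if "base_at s x" "openin X W" "x \<in> W" for s x W
    using that unfolding base_at_def by blast
  have uniq: "x = y" if b: "base_at s x" "base_at s y" for s x y
  proof (rule ccontr)
    assume "x \<noteq> y"
    moreover have "x \<in> topspace X" "y \<in> topspace X" using b by (auto simp: base_at_def)
    ultimately have "openin X (topspace X - {y})" "x \<in> topspace X - {y}"
      using closedin_Hausdorff_singleton[OF H] by auto
    from base_atD[OF b(1) this] obtain i where "N (s i) \<subseteq> topspace X - {y}" ..
    then show False using b(2) by (auto simp: base_at_def)
  qed
  define p where "p s = (THE x. base_at s x)" for s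
  have p: "p s = x" if "base_at s x" for s x
    unfolding p_def by (rule the_equality[where P = "base_at s"]) (use that uniq in auto)
  define M where "M = subtopology (euclidean :: (nat \<Rightarrow> nat) topology) {s. \<exists>x. base_at s x}"
  have tM: "s \<in> topspace M \<longleftrightarrow> base_at s (p s)" for s using p by (auto simp: M_def)
  have "continuous_map M X p"
    unfolding continuous_map_eq_topcontinuous_at topcontinuous_at_def
  proof (intro ballI conjI allI impI)
    fix s W assume s: "s \<in> topspace M" and W: "openin X W \<and> p s \<in> W"
    then obtain i where i: "N (s i) \<subseteq> W" using base_atD[of s "p s" W] unfolding tM by auto
    have "open {t. \<forall>j\<in>{i}. t j = s j}" by (rule open_finite_agreement) simp
    then have "openin M ({t. t i = s i} \<inter> {s. \<exists>x. base_at s x})"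
      unfolding M_def by (intro openin_subtopology_Int) simp
    moreover have "p t \<in> W" if t: "t \<in> {t. t i = s i} \<inter> {s. \<exists>x. base_at s x}" for t
    proof -
      obtain x where x: "base_at t x" "t i = s i" using t by auto
      then have "x \<in> N (s i)" unfolding base_at_def by metis
      then show ?thesis using i p[OF x(1)] by blast
    qed
    moreover have "s \<in> {t. t i = s i} \<inter> {s. \<exists>x. base_at s x}" using s tM by auto
    ultimately show "\<exists>U. openin M U \<and> s \<in> U \<and> (\<forall>t\<in>U. p t \<in> W)" by blast
  next
    show "p \<in> topspace M \<rightarrow> topspace X" using tM by (auto simp: base_at_def)
  qed
  moreover have "\<exists>C. compactin M C \<and> p ` C = K" if K: "compactin X K" for K
  proof -
    define \<I> where "\<I> = {I. finite I \<and> K \<subseteq> (\<Union>i\<in>I. N i)}"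
    have KX: "K \<subseteq> topspace X" by (rule compactin_subset_topspace[OF K])
    have "\<I> \<noteq> {}" using net[OF K openin_topspace KX] by (auto simp: \<I>_def)
    moreover have cI: "countable \<I>"
      by (rule countable_subset[OF _ countable_Collect_finite]) (auto simp: \<I>_def)
    ultimately have rI: "range (from_nat_into \<I>) = \<I>" by (rule range_from_nat_into)
    define F where "F = from_nat_into \<I>"
    have F: "finite (F j)" "K \<subseteq> (\<Union>i\<in>F j. N i)" for j
      using rI rangeI[of F j] unfolding F_def \<I>_def by auto
    define C where "C = {s. \<forall>i. s i \<in> F i} \<inter> {s :: nat \<Rightarrow> nat. K \<inter> (\<Inter>i. N (s i)) \<noteq> {}}"
    have bC: "base_at s x" if s: "\<forall>i. s i \<in> F i" and x: "x \<in> K" "\<forall>i. x \<in> N (s i)" for s x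
      unfolding base_at_def
    proof (intro conjI allI impI)
      show xX: "x \<in> topspace X" using x(1) KX by blast
      fix W assume W: "openin X W \<and> x \<in> W"
      have "neighbourhood_base_of (closedin X) X" using reg by (simp add: neighbourhood_base_of_closedin)
      then obtain U D where U: "openin X U" "closedin X D" "x \<in> U" "U \<subseteq> D" "D \<subseteq> W"
        using W unfolding neighbourhood_base_of by metis
      \<comment> \<open>\<open>I1\<close> covers the part of \<open>K\<close> near \<open>x\<close> inside \<open>W\<close>, and \<open>I2\<close> covers the rest of \<open>K\<close> away from \<open>x\<close>.\<close>
      have "compactin X (D \<inter> K)" by (rule closed_Int_compactin[OF U(2) K])
      then obtain I1 where I1: "finite I1" "D \<inter> K \<subseteq> (\<Union>i\<in>I1. N i)" "(\<Union>i\<in>I1. N i) \<subseteq> W"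
        using net[of "D \<inter> K" W] W U(5) by auto
      have "closedin X (topspace X - U)" using U(1) by blast
      then have "compactin X ((topspace X - U) \<inter> K)" by (rule closed_Int_compactin[OF _ K])
      moreover have "openin X (topspace X - {x})" using closedin_Hausdorff_singleton[OF H xX] by auto
      moreover have "(topspace X - U) \<inter> K \<subseteq> topspace X - {x}" using U(3) by auto
      ultimately obtain I2 where I2: "finite I2" "(topspace X - U) \<inter> K \<subseteq> (\<Union>i\<in>I2. N i)"
        "(\<Union>i\<in>I2. N i) \<subseteq> topspace X - {x}"
        using net by meson
      have "K \<subseteq> (D \<inter> K) \<union> ((topspace X - U) \<inter> K)" using KX U(4) by blast
      then have "K \<subseteq> (\<Union>i\<in>I1 \<union> I2. N i)" using I1(2) I2(2) by blast
      then have "I1 \<union> I2 \<in> range F" using I1(1) I2(1) unfolding F_def rI by (simp add: \<I>_def)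
      then obtain j where j: "F j = I1 \<union> I2" by (metis imageE)
      \<comment> \<open>\<open>F j\<close> consists of indices of sets inside \<open>W\<close> and of sets missing \<open>x\<close>; the choice \<open>s j\<close> is of the first kind.\<close>
      have "s j \<notin> I2" using x(2) I2(3) by auto
      then have "s j \<in> I1" using s j by auto
      then show "\<exists>i. N (s i) \<subseteq> W" using I1(3) by blast
    qed (use x in auto)
    have "closed {s :: nat \<Rightarrow> nat. K \<inter> (\<Inter>i. N (s i)) \<noteq> {}}"
      unfolding closed_def
    proof (subst open_subopen, intro ballI)
      fix s assume "s \<in> - {s :: nat \<Rightarrow> nat. K \<inter> (\<Inter>i. N (s i)) \<noteq> {}}"
      then have "K \<inter> (\<Inter>i. N (s i)) = {}" by simp
      with compactin_Int_closed_family_empty[OF K, of "\<lambda>i. N (s i)"] clN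
      obtain J :: "nat set" where J: "finite J" "K \<inter> (\<Inter>i\<in>J. N (s i)) = {}"
        by metis
      have "{t. \<forall>i\<in>J. t i = s i} \<subseteq> - {s :: nat \<Rightarrow> nat. K \<inter> (\<Inter>i. N (s i)) \<noteq> {}}"
      proof
        fix t assume "t \<in> {t. \<forall>i\<in>J. t i = s i}"
        then have "(\<Inter>i\<in>J. N (t i)) = (\<Inter>i\<in>J. N (s i))" by simp
        moreover have "(\<Inter>i. N (t i)) \<subseteq> (\<Inter>i\<in>J. N (t i))" by blast
        ultimately have "K \<inter> (\<Inter>i. N (t i)) \<subseteq> K \<inter> (\<Inter>i\<in>J. N (s i))" by auto
        then show "t \<in> - {s :: nat \<Rightarrow> nat. K \<inter> (\<Inter>i. N (s i)) \<noteq> {}}" using J(2) by auto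
      qed
      then show "\<exists>T. open T \<and> s \<in> T \<and> T \<subseteq> - {s :: nat \<Rightarrow> nat. K \<inter> (\<Inter>i. N (s i)) \<noteq> {}}"
        using open_finite_agreement[OF J(1), of s] by blast
    qed
    then have "compact C"
      unfolding C_def using F(1) by (intro compact_Int_closed compact_finite_choices)
    moreover have "C \<subseteq> {s. \<exists>x. base_at s x}"
    proof
      fix s assume "s \<in> C"
      then obtain x where "\<forall>i. s i \<in> F i" "x \<in> K" "\<forall>i. x \<in> N (s i)" unfolding C_def by auto
      then have "base_at s x" by (rule bC)
      then show "s \<in> {s. \<exists>x. base_at s x}" by auto
    qed
    ultimately have "compactin M C" unfolding M_def by (simp add: compactin_subtopology)
    moreover have "p ` C = K"
    proof
      show "p ` C \<subseteq> K"
      proof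
        fix z assume "z \<in> p ` C"
        then obtain s where "s \<in> C" "z = p s" by auto
        then obtain x where x: "\<forall>i. s i \<in> F i" "x \<in> K" "\<forall>i. x \<in> N (s i)" unfolding C_def by auto
        then have "p s = x" using p bC by metis
        then show "z \<in> K" using x(2) \<open>z = p s\<close> by simp
      qed
      show "K \<subseteq> p ` C"
      proof
        fix x assume x: "x \<in> K"
        then have "\<forall>j. \<exists>i. i \<in> F j \<and> x \<in> N i" using F(2) by blast
        then obtain s where s: "\<forall>j. s j \<in> F j" "\<forall>j. x \<in> N (s j)" by metis
        then have "s \<in> C" using x unfolding C_def by auto
        moreover have "p s = x" by (rule p[OF bC[OF s(1) x s(2)]])
        ultimately show "x \<in> p ` C" by force
      qed
    qed
    ultimately show ?thesis by blast
  qed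
  moreover have "second_countable M"
    unfolding M_def by (rule second_countable_subtopology[OF second_countable_euclidean])
  moreover have "metrizable_space M"
    unfolding M_def by (rule metrizable_space_subtopology[OF metrizable_space_nat_sequences])
  ultimately show ?thesis using that by blast
qed

section \<open>Function spaces\<close>

text \<open>Pass to the evaluation. Let \<open>p : M \<rightarrow> X\<close> be a compact-covering map from a separable metrizable space and
  consider \<open>F (a, (b, m)) = f (a, b) (p m)\<close> on \<open>A \<times> (B \<times> M)\<close>. It is continuous in \<open>a\<close> because the topology of
  \<open>T\<close> is finer than the pointwise one. It is sequentially continuous in \<open>(b, m)\<close> because evaluation is, hence
  continuous as \<open>B \<times> M\<close> is metrizable. So for all \<open>a\<close> outside a meager set, \<open>F\<close> is continuous at \<open>(a, (b, m))\<close>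
  for all \<open>b\<close> and \<open>m\<close>. For such \<open>a\<close>, lift a compact \<open>K \<subseteq> X\<close> to a compact subset of \<open>M\<close>: the tube lemma yields
  continuity of \<open>f\<close> at \<open>(a, b)\<close> for the compact-open topology, which is finer than the topology of \<open>T\<close>.\<close>

lemma CC_Maslyuchenko_function_space:
  fixes X :: "'x topology" and Y :: "'a topology" and T :: "('x \<Rightarrow> 'a) topology"
  assumes X: "aleph0_space X" and Y: "CC_Maslyuchenko Y"
    and T: "sequentially_admissible_topology X Y T"
  shows "CC_Maslyuchenko T"
proof (rule CC_MaslyuchenkoI)
  fix A B :: "(nat \<Rightarrow> real) topology" and f
  assume A: "second_countable A" "metrizable_space A" and B: "second_countable B" "metrizable_space B"
    and f: "separately_continuous A B T f"
  obtain M :: "(nat \<Rightarrow> nat) topology" and p where M: "second_countable M" "metrizable_space M"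
    and p: "continuous_map M X p" and lift: "\<And>K. compactin X K \<Longrightarrow> \<exists>C. compactin M C \<and> p ` C = K"
    using aleph0_space_compact_covering_image[OF X] by metis
  have TC: "topspace T \<subseteq> cont_maps X Y"
    and Tp: "\<And>U. openin (subtopology (pointwise_topology X Y) (topspace T)) U \<Longrightarrow> openin T U"
    and Tk: "\<And>U. openin T U \<Longrightarrow> openin (subtopology (compact_open_topology X Y) (topspace T)) U"
    and ev: "sequentially_continuous_map (prod_topology T X) Y (\<lambda>(h, x). h x)"
    using T by (auto simp: sequentially_admissible_topology_def admissible_topology_def)
  have pX: "p m \<in> topspace X" if "m \<in> topspace M" for m using p that by (auto simp: continuous_map_def)
  have hY: "h x \<in> topspace Y" if "h \<in> topspace T" "x \<in> topspace X" for h x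
    using TC that by (auto simp: cont_maps_def continuous_map_def)
  have point: "continuous_map T Y (\<lambda>h. h x)" if x: "x \<in> topspace X" for x
    unfolding continuous_map_def
  proof (intro conjI allI impI)
    show "(\<lambda>h. h x) \<in> topspace T \<rightarrow> topspace Y" using hY x by auto
    fix U assume U: "openin Y U"
    have "openin (pointwise_topology X Y) {h \<in> cont_maps X Y. h ` {x} \<subseteq> U}"
      unfolding pointwise_topology_def
      by (rule topology_generated_by_Basis) (use x U in \<open>auto intro!: exI[of _ "{x}"]\<close>)
    then have "openin T ({h \<in> cont_maps X Y. h ` {x} \<subseteq> U} \<inter> topspace T)"
      by (intro Tp openin_subtopology_Int)
    moreover have "{h \<in> cont_maps X Y. h ` {x} \<subseteq> U} \<inter> topspace T = {h \<in> topspace T. h x \<in> U}"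
      using TC by auto
    ultimately show "openin T {h \<in> topspace T. h x \<in> U}" by simp
  qed
  define F where "F = (\<lambda>(a, b, m). f (a, b) (p m))"
  have mBM: "metrizable_space (prod_topology B M)" using B(2) M(2) by (simp add: metrizable_space_prod_topology)
  have "separately_continuous A (prod_topology B M) Y F"
    unfolding separately_continuous_def
  proof (intro conjI ballI)
    fix a assume a: "a \<in> topspace A"
    have fa: "continuous_map B T (\<lambda>b. f (a, b))" by (rule separately_continuousD(1)[OF f a])
    let ?h = "\<lambda>q. (f (a, fst q), p (snd q))"
    have h: "continuous_map (prod_topology B M) (prod_topology T X) ?h"
      using continuous_map_compose[OF continuous_map_fst[of B M] fa]
        continuous_map_compose[OF continuous_map_snd[of B M] p]
      by (simp add: continuous_map_paired o_def)
    have Fh: "F (a, q) = (\<lambda>(h, x). h x) (?h q)" for q by (simp add: F_def case_prod_unfold)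
    show "continuous_map (prod_topology B M) Y (\<lambda>q. F (a, q))"
    proof (rule sequentially_continuous_imp_continuous_map[OF mBM])
      show "(\<lambda>q. F (a, q)) \<in> topspace (prod_topology B M) \<rightarrow> topspace Y"
        using hY pX fa by (auto simp: F_def continuous_map_def)
      fix s l assume s: "range s \<subseteq> topspace (prod_topology B M)"
        and l: "limitin (prod_topology B M) s l sequentially"
      have "limitin (prod_topology T X) (?h \<circ> s) (?h l) sequentially" by (rule continuous_map_limit[OF h l])
      moreover have "range (?h \<circ> s) \<subseteq> topspace (prod_topology T X)"
        unfolding image_comp[symmetric]
        using image_mono[OF s] continuous_map_image_subset_topspace[OF h] by (rule order_trans)
      ultimately have "limitin Y ((\<lambda>(h, x). h x) \<circ> (?h \<circ> s)) ((\<lambda>(h, x). h x) (?h l)) sequentially"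
        using ev unfolding sequentially_continuous_map_def by blast
      moreover have "(\<lambda>(h, x). h x) \<circ> (?h \<circ> s) = (\<lambda>q. F (a, q)) \<circ> s" by (auto simp: Fh)
      ultimately show "limitin Y ((\<lambda>q. F (a, q)) \<circ> s) (F (a, l)) sequentially" by (simp add: Fh)
    qed
  next
    fix q assume "q \<in> topspace (prod_topology B M)"
    then obtain b m where q: "q = (b, m)" "b \<in> topspace B" "m \<in> topspace M" by auto
    show "continuous_map A Y (\<lambda>a. F (a, q))"
      using continuous_map_compose[OF separately_continuousD(2)[OF f q(2)] point[OF pX[OF q(3)]]]
      by (simp add: F_def q(1) o_def)
  qed
  then have mF: "meager_in A (fst ` disc_points (prod_topology A (prod_topology B M)) Y F)"
    by (intro CC_meager_disc[OF Y A second_countable_prod_topology[OF B(1) M(1)] mBM])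
  let ?AB = "prod_topology A B"
  have "fst ` disc_points ?AB T f \<subseteq> fst ` disc_points (prod_topology A (prod_topology B M)) Y F"
  proof (rule subsetI, rule ccontr)
    fix a assume a: "a \<in> fst ` disc_points ?AB T f"
      "a \<notin> fst ` disc_points (prod_topology A (prod_topology B M)) Y F"
    from a(1) obtain b where ab: "(a, b) \<in> disc_points ?AB T f" by force
    have aA: "a \<in> topspace A" and bB: "b \<in> topspace B" using ab by (auto simp: disc_points_def)
    have cF: "topcontinuous_at (prod_topology A (prod_topology B M)) Y F (a, b, m)"
      if m: "m \<in> topspace M" for m
    proof (rule ccontr)
      assume "\<not> ?thesis"
      then have "(a, b, m) \<in> disc_points (prod_topology A (prod_topology B M)) Y F"
        using aA bB m by (simp add: disc_points_def)
      then show False using a(2) by force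
    qed
    \<comment> \<open>The tube lemma needs \<open>M\<close> split off from \<open>A \<times> B\<close>.\<close>
    let ?as = "\<lambda>r. (fst (fst r), snd (fst r), snd r)"
    have as: "continuous_map (prod_topology ?AB M) (prod_topology A (prod_topology B M)) ?as"
      using continuous_map_compose[OF continuous_map_fst[of ?AB M] continuous_map_fst[of A B]]
        continuous_map_compose[OF continuous_map_fst[of ?AB M] continuous_map_snd[of A B]]
        continuous_map_snd[of ?AB M]
      by (simp add: continuous_map_paired o_def)
    have fT: "f \<in> topspace ?AB \<rightarrow> topspace T" by (rule separately_continuousD(3)[OF f])
    let ?S = "{{f \<in> cont_maps X Y. f ` K \<subseteq> U} |K U. compactin X K \<and> openin Y U}"
    have "cont_maps X Y \<in> ?S" by (rule CollectI, intro exI[of _ "{}"] exI[of _ "topspace Y"]) auto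
    then have "cont_maps X Y \<subseteq> \<Union>?S" by (rule Union_upper)
    then have tk: "cont_maps X Y \<subseteq> topspace (compact_open_topology X Y)"
      by (simp add: compact_open_topology_def)
    have ck: "topcontinuous_at ?AB (compact_open_topology X Y) f (a, b)"
      unfolding compact_open_topology_def
    proof (rule topcontinuous_at_topology_generated_by)
      show "(a, b) \<in> topspace ?AB" using aA bB by simp
      show "f \<in> topspace ?AB \<rightarrow> topspace (topology_generated_by ?S)"
        using fT TC tk unfolding compact_open_topology_def by blast
      fix S assume S: "S \<in> ?S" "f (a, b) \<in> S"
      then obtain K U where KU: "compactin X K" "openin Y U" "S = {f \<in> cont_maps X Y. f ` K \<subseteq> U}"
        by auto
      obtain C where C: "compactin M C" "p ` C = K" using lift[OF KU(1)] by auto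
      have CM: "C \<subseteq> topspace M" by (rule compactin_subset_topspace[OF C(1)])
      have "\<exists>V. openin ?AB V \<and> (a, b) \<in> V \<and> (\<forall>q\<in>V. \<forall>m\<in>C. (F \<circ> ?as) (q, m) \<in> U)"
      proof (rule tube_topcontinuous_at[OF C(1) _ _ KU(2)])
        show "topcontinuous_at (prod_topology ?AB M) Y (F \<circ> ?as) ((a, b), m)" if "m \<in> C" for m
        proof (rule topcontinuous_at_compose_right[OF _ as])
          show "topcontinuous_at (prod_topology A (prod_topology B M)) Y F (?as ((a, b), m))"
            using cF CM that by auto
        qed (use aA bB CM that in auto)
        show "(F \<circ> ?as) ((a, b), m) \<in> U" if "m \<in> C" for m
          using S(2) C(2) KU(3) that by (auto simp: F_def)
      qed (use aA bB in auto)
      then obtain V where V: "openin ?AB V" "(a, b) \<in> V" "\<forall>q\<in>V. \<forall>m\<in>C. (F \<circ> ?as) (q, m) \<in> U"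
        by auto
      have "f q \<in> S" if q: "q \<in> V" for q
      proof -
        have "q \<in> topspace ?AB" using q openin_subset[OF V(1)] by blast
        then have "f q \<in> cont_maps X Y" using fT TC by blast
        moreover have "f q (p m) \<in> U" if "m \<in> C" for m using V(3) q that by (force simp: F_def)
        ultimately show ?thesis using KU(3) C(2) by auto
      qed
      then show "\<exists>V. openin ?AB V \<and> (a, b) \<in> V \<and> (\<forall>q\<in>V. f q \<in> S)" using V(1,2) by auto
    qed
    have "topspace (subtopology (compact_open_topology X Y) (topspace T)) = topspace T"
      using TC tk by auto
    then have c: "topcontinuous_at ?AB (subtopology (compact_open_topology X Y) (topspace T)) f (a, b)"
      using fT by (intro topcontinuous_at_subtopology[OF ck]) simp
    have "topcontinuous_at ?AB T f (a, b)"
      unfolding topcontinuous_at_def using topcontinuous_atD[OF c Tk] fT aA bB by auto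
    then show False using ab by (simp add: disc_points_def)
  qed
  then show "meager_in A (fst ` disc_points ?AB T f)" by (rule meager_in_subset[OF mF])
qed

section \<open>M-stability\<close>

theorem theorem5p1:
  shows "M_stable
    (CC_Maslyuchenko :: 'a topology \<Rightarrow> bool)
    (CC_Maslyuchenko :: 'b topology \<Rightarrow> bool)
    (CC_Maslyuchenko :: ('i \<Rightarrow> 'a) topology \<Rightarrow> bool)
    (CC_Maslyuchenko :: ('x \<Rightarrow> 'a) topology \<Rightarrow> bool)"
  unfolding M_stable_def
proof (intro conjI)
  show "contains_metrizable (CC_Maslyuchenko :: 'a topology \<Rightarrow> bool)"
    unfolding contains_metrizable_def by (intro allI impI metrizable_imp_CC_Maslyuchenko)
  show "closed_under_subspaces (CC_Maslyuchenko :: 'a topology \<Rightarrow> bool)"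
    unfolding closed_under_subspaces_def by (intro allI impI CC_Maslyuchenko_subtopology, elim conjE)
  show "closed_under_homeomorphic_images (CC_Maslyuchenko :: 'a topology \<Rightarrow> bool)
      (CC_Maslyuchenko :: 'b topology \<Rightarrow> bool)"
    unfolding closed_under_homeomorphic_images_def
    by (intro allI impI, elim conjE) (rule CC_Maslyuchenko_homeomorphic)
  show "closed_under_countable_products (CC_Maslyuchenko :: 'a topology \<Rightarrow> bool)
      (CC_Maslyuchenko :: ('i \<Rightarrow> 'a) topology \<Rightarrow> bool)"
    unfolding closed_under_countable_products_def
    by (intro allI impI, elim conjE) (rule CC_Maslyuchenko_product, auto)
  show "closed_under_fibered_preimages (CC_Maslyuchenko :: 'a topology \<Rightarrow> bool)
      (CC_Maslyuchenko :: 'b topology \<Rightarrow> bool)"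
    unfolding closed_under_fibered_preimages_def
  proof (intro allI impI, elim conjE)
    fix X :: "'a topology" and Y :: "'b topology" and f
    assume Y: "CC_Maslyuchenko Y" and f: "continuous_map X Y f"
      and loc: "\<forall>y\<in>topspace Y. \<exists>N. nbhd_in Y {y} N \<and>
        CC_Maslyuchenko (subtopology X {x \<in> topspace X. f x \<in> N})"
    show "CC_Maslyuchenko X" by (rule CC_Maslyuchenko_fibered_preimage[OF Y f bspec[OF loc]])
  qed
  show "closed_under_strong_sigma_sums (CC_Maslyuchenko :: 'a topology \<Rightarrow> bool)"
    unfolding closed_under_strong_sigma_sums_def
  proof (intro allI impI, elim conjE)
    fix X :: "'a topology" and A :: "nat \<Rightarrow> 'a set"
    assume cover: "topspace X = (\<Union>n. A n)" and inc: "incseq A"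
      and A: "\<forall>n. closedin X (A n) \<and> CC_Maslyuchenko (subtopology X (A n))"
      and seq: "\<forall>(s :: nat \<Rightarrow> 'a) l. range s \<subseteq> topspace X \<and> limitin X s l sequentially \<longrightarrow>
        (\<exists>n. range s \<subseteq> A n)"
    show "CC_Maslyuchenko X"
    proof (rule CC_Maslyuchenko_strong_sigma_sum[OF cover])
      show "\<exists>n. range s \<subseteq> A n" if "range s \<subseteq> topspace X" "limitin X s l sequentially"
        for s :: "nat \<Rightarrow> 'a" and l
        using mp[OF spec[OF spec[OF seq, of s], of l] conjI[OF that]] .
    qed (use A in auto)
  qed
  show "closed_under_retral_unions (CC_Maslyuchenko :: 'a topology \<Rightarrow> bool)"
    unfolding closed_under_retral_unions_def
  proof (intro allI impI, elim conjE)
    fix X :: "'a topology" and n :: nat and A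
    assume cover: "topspace X = (\<Union>i\<in>{1..n}. A i)"
      and A: "\<forall>i\<in>{1..n}. bar_G_delta_in X (A i) \<and> neighborhood_retract_in X (A i) \<and>
        CC_Maslyuchenko (subtopology X (A i))"
    show "CC_Maslyuchenko X"
      by (rule CC_Maslyuchenko_retral_union[OF finite_atLeastAtMost cover]) (use A in auto)
  qed
  show "closed_under_Michael_modifications (CC_Maslyuchenko :: 'a topology \<Rightarrow> bool)"
    unfolding closed_under_Michael_modifications_def
    by (intro allI impI, elim conjE) (rule CC_Maslyuchenko_Michael_modification)
  show "closed_under_function_spaces (CC_Maslyuchenko :: 'a topology \<Rightarrow> bool)
      (CC_Maslyuchenko :: ('x \<Rightarrow> 'a) topology \<Rightarrow> bool)"
    unfolding closed_under_function_spaces_def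
    by (intro allI impI, elim conjE) (rule CC_Maslyuchenko_function_space)
qed

end
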